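(* For every $\epsilon > 0$ there exists $c > 0$ such that for every finite convex set $A \subset \mathbb{R}$, \[ |A+A| \geq c\,|A|^{\frac{46}{29} - \epsilon}. \]
   Context: A finite set $A = \{a_1 < a_2 < \dots < a_n\} \subset \mathbb{R}$ is called convex if the sequence of consecutive gaps $(a_{j+1}-a_j)_{j=1}^{n-1}$ is strictly increasing. $A+A = \{a_1+a_2 : a_1,a_2\in A\}$. *)

theory Defs
  imports Complex_Main
begin

definition sumset :: "real set \<Rightarrow> real set" where
  "sumset A = {a + b | a b. a \<in> A \<and> b \<in> A}"

definition convex_set :: "real set \<Rightarrow> bool" where
  "convex_set A \<longleftrightarrow> finite A \<and>
     (let xs = sorted_list_of_set A in
       \<forall>j. j + 2 < length xs \<longrightarrow> xs ! (j+1) - xs ! j < xs ! (j+2) - xs ! (j+1))"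

end

theory Submission
  imports Defs "HOL-Probability.Probability_Mass_Function"
begin

text \<open>All estimates are linear inequalities between Shannon entropies. Squeezing turns convexity of \<open>A\<close>
  into control: for \<open>\<alpha> \<in> A\<close> and \<open>\<alpha> = \<beta> + \<gamma>\<close>, \<open>3H(\<beta>,\<gamma>) \<le> log |A| + 2H(\<beta>) + 2H(\<gamma>)\<close> up to
  \<open>O(log log |A|)\<close>, also conditionally on a further variable. The uniform law on additive quadruples
  \<open>b - c = d - e\<close> is symmetric under exchanging \<open>c\<close> and \<open>d\<close>, so the graph of popular differences behaves
  like a union of cliques. Attaching quadruples to the law of pairs of sums with a popular
  difference, and gluing conditionally independent copies, yields laws whose entropies cannot all
  be consistent unless \<open>|A + A| \<ge> |A|\<close> to the power \<open>1 + 129/220 - o(1)\<close>, which exceeds \<open>46/29\<close>.\<close>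

section \<open>Control for convex sets\<close>


text \<open>The obstacle is to use several popularity statements about the same difference without
  paying for a pigeonholing each time. A law keeps all its marginals at once, so no level sets are
  chosen and every further estimate is one more linear inequality. Monotonicity, submodularity and
  control bound joint entropies only from above. The lower bounds come from the additive energy of
  \<open>A\<close> and from gluing, where submodularity becomes an equality. Small doubling enters
  solely through the bound \<open>L + \<kappa>\<close> for the entropy of a variable with values in
  \<open>sumset A\<close>. Beyond finiteness, convexity is used once: a difference and a rank gap
  determine the pair. The error is O(log log |A|) because it counts pairs of dyadic weight levels.
  The value 129/220 is the ratio 3096/5280 of two coefficients in an explicit linear combination;
  17/29 = 46/29 - 1 lies slightly below it.\<close>

lemma convex_gap_less:
  fixes xs :: "real list"
  assumes cv: "\<forall>j. j + 2 < length xs \<longrightarrow> xs!(j+1) - xs!j < xs!(j+2) - xs!(j+1)"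
  shows "i < j \<Longrightarrow> j + 1 < length xs \<Longrightarrow> xs!(i+1) - xs!i < xs!(j+1) - xs!j"
proof (induction j)
  case (Suc j)
  have step: "xs!(j+1) - xs!j < xs!(Suc j + 1) - xs!(Suc j)"
    using cv[rule_format, of j] Suc.prems by (simp add: numeral_2_eq_2)
  show ?case
  proof (cases "i = j")
    case False
    then have "xs!(i+1) - xs!i < xs!(j+1) - xs!j" using Suc by simp
    then show ?thesis using step by linarith
  qed (use step in simp)
qed simp

lemma convex_shift_less:
  fixes xs :: "real list"
  assumes cv: "\<forall>j. j + 2 < length xs \<longrightarrow> xs!(j+1) - xs!j < xs!(j+2) - xs!(j+1)"
  shows "i < j \<Longrightarrow> j + Suc g < length xs \<Longrightarrow> xs!(i + Suc g) - xs!i < xs!(j + Suc g) - xs!j"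
proof (induction g)
  case 0
  then show ?case using convex_gap_less[OF cv, of i j] by simp
next
  case (Suc g)
  have "xs!(i + Suc g + 1) - xs!(i + Suc g) < xs!(j + Suc g + 1) - xs!(j + Suc g)"
    using convex_gap_less[OF cv, of "i + Suc g" "j + Suc g"] Suc.prems by simp
  moreover have "xs!(i + Suc g) - xs!i < xs!(j + Suc g) - xs!j" using Suc by simp
  ultimately show ?case by simp
qed

lemma card_between_nth:
  fixes xs :: "real list"
  assumes s: "sorted_wrt (<) xs" and ij: "i \<le> j" "j < length xs"
  shows "card {t \<in> set xs. xs!i < t \<and> t \<le> xs!j} = j - i"
proof -
  have less: "xs!k < xs!l \<longleftrightarrow> k < l" if "k < length xs" "l < length xs" for k l
    using that sorted_wrt_nth_less[OF s, of k l] sorted_wrt_nth_less[OF s, of l k]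
    by (cases k l rule: linorder_cases) auto
  have "{t \<in> set xs. xs!i < t \<and> t \<le> xs!j} = (!) xs ` {i<..j}"
  proof (intro set_eqI iffI)
    fix t assume "t \<in> {t \<in> set xs. xs!i < t \<and> t \<le> xs!j}"
    then obtain k where k: "k < length xs" "t = xs!k" "xs!i < xs!k" "xs!k \<le> xs!j"
      by (auto simp: in_set_conv_nth)
    then have "i < k" "k \<le> j" using less[of i k] less[of j k] ij by auto
    then show "t \<in> (!) xs ` {i<..j}" using k by auto
  next
    fix t assume "t \<in> (!) xs ` {i<..j}"
    then obtain k where "t = xs!k" "i < k" "k \<le> j" by auto
    then show "t \<in> {t \<in> set xs. xs!i < t \<and> t \<le> xs!j}"
      using less[of i k] less[of j k] ij by auto
  qed
  moreover have "inj_on ((!) xs) {i<..j}"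
    using less ij by (intro inj_onI) (metis greaterThanAtMost_iff le_less_trans less_irrefl linorder_neqE_nat)
  ultimately show ?thesis by (simp add: card_image)
qed

text \<open>At a fixed rank distance the difference of two elements strictly increases with the rank
  of the smaller one, so equal differences spanning equally many elements must start at the same
  place.\<close>

lemma convex_shift_unique:
  assumes A: "convex_set A" and mem: "a \<in> A" "a' \<in> A" "a + d \<in> A" "a' + d \<in> A" "0 < d"
    and eq: "card {t \<in> A. a < t \<and> t \<le> a + d} = card {t \<in> A. a' < t \<and> t \<le> a' + d}"
  shows "a = a'"
proof -
  define xs where "xs = sorted_list_of_set A"
  have fin: "finite A" using A by (simp add: convex_set_def)
  have cv: "\<forall>j. j + 2 < length xs \<longrightarrow> xs!(j+1) - xs!j < xs!(j+2) - xs!(j+1)"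
    using A unfolding convex_set_def Let_def xs_def by blast
  have set: "set xs = A" using fin by (simp add: xs_def)
  have s: "sorted_wrt (<) xs" by (simp add: xs_def)
  have less: "xs!k < xs!l \<longleftrightarrow> k < l" if "k < length xs" "l < length xs" for k l
    using that sorted_wrt_nth_less[OF s, of k l] sorted_wrt_nth_less[OF s, of l k]
    by (cases k l rule: linorder_cases) auto
  have pos: "\<exists>i g. i + Suc g < length xs \<and> xs!i = b \<and> xs!(i + Suc g) = b + d \<and>
      card {t \<in> A. b < t \<and> t \<le> b + d} = Suc g" if bA: "b \<in> A" "b + d \<in> A" for b
  proof -
    obtain i where i: "i < length xs" "xs!i = b"
      using bA(1) unfolding set[symmetric] in_set_conv_nth by blast
    obtain j where j: "j < length xs" "xs!j = b + d"
      using bA(2) unfolding set[symmetric] in_set_conv_nth by blast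
    note ij = i(1) j(1) i(2) j(2)
    have "i < j" using less[of i j] mem(5) ij by simp
    then obtain g where "j = i + Suc g" using less_imp_Suc_add by auto
    moreover have "card {t \<in> A. b < t \<and> t \<le> b + d} = j - i"
      using card_between_nth[OF s, of i j] ij \<open>i < j\<close> set by simp
    ultimately show ?thesis using ij by auto
  qed
  obtain i g where i: "i + Suc g < length xs" "xs!i = a" "xs!(i + Suc g) = a + d"
      "card {t \<in> A. a < t \<and> t \<le> a + d} = Suc g" using pos[of a] mem by auto
  obtain j h where j: "j + Suc h < length xs" "xs!j = a'" "xs!(j + Suc h) = a' + d"
      "card {t \<in> A. a' < t \<and> t \<le> a' + d} = Suc h" using pos[of a'] mem by auto
  have gh: "g = h" using i j eq by simp
  have "\<not> i < j" using convex_shift_less[OF cv, of i j g] i j gh by auto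
  moreover have "\<not> j < i" using convex_shift_less[OF cv, of j i g] i j gh by auto
  ultimately show ?thesis using i j by (metis linorder_neqE_nat)
qed

text \<open>Pigeonhole: the half-open intervals from an element of \<open>R\<close> to its
  successor, shifted by \<open>c\<close>, are disjoint and share the points of \<open>T\<close>. The
  shift lets one statement serve both for gaps measured in \<open>B\<close> (shift 0) and for gaps
  of the translate by \<open>c\<close> measured in \<open>A\<close>.\<close>

lemma few_large_gaps:
  fixes R T :: "real set" and c s :: real
  assumes fin: "finite R" "finite T" and s: "0 < s"
  defines "nx \<equiv> \<lambda>b. Min {b' \<in> R. b < b'}"
  shows "real (card {b \<in> R. (\<exists>b'\<in>R. b < b') \<and>
      real (card T) / s < real (card {t \<in> T. b + c < t \<and> t \<le> nx b + c})}) \<le> s"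
proof -
  define X where "X = {b \<in> R. (\<exists>b'\<in>R. b < b') \<and>
      real (card T) / s < real (card {t \<in> T. b + c < t \<and> t \<le> nx b + c})}"
  define G where "G b = {t \<in> T. b + c < t \<and> t \<le> nx b + c}" for b
  have finX: "finite X" using fin by (simp add: X_def)
  have disj: "G b \<inter> G b' = {}" if "b \<in> X" "b' \<in> X" "b < b'" for b b'
  proof -
    have "nx b \<le> b'" unfolding nx_def using that fin by (intro Min_le) (auto simp: X_def)
    then show ?thesis by (auto simp: G_def)
  qed
  have "\<forall>i\<in>X. \<forall>j\<in>X. i \<noteq> j \<longrightarrow> G i \<inter> G j = {}"
    using disj by (metis Int_commute linorder_neqE_linordered_idom)
  then have "(\<Sum>b\<in>X. card (G b)) = card (\<Union>b\<in>X. G b)"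
    using finX fin by (subst card_UN_disjoint) (auto simp: G_def)
  also have "\<dots> \<le> card T" using fin by (intro card_mono) (auto simp: G_def)
  finally have sum: "(\<Sum>b\<in>X. real (card (G b))) \<le> real (card T)"
    by (metis of_nat_le_iff of_nat_sum)
  have "real (card X) * (real (card T) / s) \<le> (\<Sum>b\<in>X. real (card (G b)))"
    by (rule order_trans[OF _ sum_mono[of X "\<lambda>_. real (card T) / s"]]) (auto simp: X_def G_def)
  then have le: "real (card X) * (real (card T) / s) \<le> real (card T)" using sum by linarith
  show ?thesis
  proof (cases "card T = 0")
    case True
    then have "X = {}" using fin by (auto simp: X_def)
    then show ?thesis using s unfolding X_def[symmetric] by simp
  next
    case False
    then show ?thesis using le s unfolding X_def[symmetric] by (simp add: field_simps)
  qed
qed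

lemma card_nat_real_le: "0 \<le> z \<Longrightarrow> real (card {g::nat. 1 \<le> g \<and> real g \<le> z}) \<le> z"
proof -
  assume z: "0 \<le> z"
  have "{g::nat. 1 \<le> g \<and> real g \<le> z} \<subseteq> {1..nat \<lfloor>z\<rfloor>}" by (auto simp: le_nat_floor)
  then have "card {g::nat. 1 \<le> g \<and> real g \<le> z} \<le> nat \<lfloor>z\<rfloor>"
    by (metis card_atLeastAtMost card_mono diff_Suc_1 finite_atLeastAtMost)
  then show ?thesis using z by linarith
qed

section \<open>Incidences \<open>b + c \<in> A\<close>, counted and weighted\<close>

definition incid :: "real set \<Rightarrow> real set \<Rightarrow> real set \<Rightarrow> (real \<times> real) set" where
  "incid A B C = {(b, c). b \<in> B \<and> c \<in> C \<and> b + c \<in> A}"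

text \<open>Squeezing: two representations of the same \<open>c\<close> that are consecutive in \<open>B\<close> are recovered from
  the smaller \<open>b\<close> and the two rank gaps, because \<open>A\<close> is convex.\<close>
lemma incid_le_param:
  assumes A: "convex_set A" and fin: "finite B" "finite C" and s: "0 < s"
  shows "real (card (incid A B C)) \<le>
    real (card C) * (1 + 2 * s) + real (card B) * (real (card B) / s) * (real (card A) / s)"
proof -
  have finA: "finite A" using A by (simp add: convex_set_def)
  define R where "R c = {b \<in> B. b + c \<in> A}" for c
  define nx where "nx c b = Min {b' \<in> R c. b < b'}" for c b
  define gB where "gB c b = card {t \<in> B. b < t \<and> t \<le> nx c b}" for c b
  define gA where "gA c b = card {t \<in> A. b + c < t \<and> t \<le> nx c b + c}" for c b
  define Gd where "Gd = {(b, c). c \<in> C \<and> b \<in> R c \<and> (\<exists>b'\<in>R c. b < b') \<and>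
     real (gB c b) \<le> real (card B) / s \<and> real (gA c b) \<le> real (card A) / s}"
  have finR: "finite (R c)" for c using fin by (simp add: R_def)
  have finG: "finite Gd" by (rule finite_subset[of _ "B \<times> C"]) (auto simp: Gd_def R_def fin)
  have nx: "nx c b \<in> R c" "b < nx c b" if "\<exists>b'\<in>R c. b < b'" for c b
  proof -
    have "nx c b \<in> {b' \<in> R c. b < b'}" unfolding nx_def using that finR by (intro Min_in) auto
    then show "nx c b \<in> R c" "b < nx c b" by auto
  qed
  \<comment> \<open>\<open>gB\<close> recovers the successor \<open>nx c b\<close>, hence the common
    difference \<open>nx c b - b\<close>; then \<open>gA\<close> and
    \<open>convex_shift_unique\<close> recover \<open>b + c\<close>.\<close>
  have inj: "inj_on (\<lambda>(b, c). (b, gB c b, gA c b)) Gd"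
  proof (rule inj_onI, clarsimp)
    fix b c c' assume h: "(b, c) \<in> Gd" "(b, c') \<in> Gd" "gB c b = gB c' b" "gA c b = gA c' b"
    have ex: "\<exists>b'\<in>R c. b < b'" "\<exists>b'\<in>R c'. b < b'" "b \<in> R c" "b \<in> R c'"
      using h by (simp_all add: Gd_def)
    have n: "nx c b \<in> B" "nx c' b \<in> B" "b < nx c b" "b < nx c' b" "b + c \<in> A" "b + c' \<in> A"
        "nx c b + c \<in> A" "nx c' b + c' \<in> A"
      using nx[OF ex(1)] nx[OF ex(2)] ex(3,4) unfolding R_def by simp_all
    have gBlt: "card {t \<in> B. b < t \<and> t \<le> u} < card {t \<in> B. b < t \<and> t \<le> v}"
      if "u < v" "v \<in> B" "b < v" for u v
    proof (rule psubset_card_mono)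
      have "{t \<in> B. b < t \<and> t \<le> u} \<subseteq> {t \<in> B. b < t \<and> t \<le> v}" using that(1) by auto
      moreover have "v \<in> {t \<in> B. b < t \<and> t \<le> v}" "v \<notin> {t \<in> B. b < t \<and> t \<le> u}" using that by simp_all
      ultimately show "{t \<in> B. b < t \<and> t \<le> u} \<subset> {t \<in> B. b < t \<and> t \<le> v}" by blast
    qed (use fin in simp)
    have eqn: "nx c' b = nx c b"
    proof (rule linorder_cases[of "nx c b" "nx c' b"])
      assume "nx c b < nx c' b"
      then show ?thesis using gBlt[OF _ n(2) n(4), of "nx c b"] h(3) unfolding gB_def by linarith
    next
      assume "nx c' b < nx c b"
      then show ?thesis using gBlt[OF _ n(1) n(3), of "nx c' b"] h(3) unfolding gB_def by linarith
    qed simp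
    have e: "b + c + (nx c b - b) = nx c b + c" "b + c' + (nx c b - b) = nx c b + c'" by simp_all
    have "b + c = b + c'"
    proof (rule convex_shift_unique[OF A n(5,6), where d = "nx c b - b"])
      show "card {t \<in> A. b + c < t \<and> t \<le> b + c + (nx c b - b)} = card {t \<in> A. b + c' < t \<and> t \<le> b + c' + (nx c b - b)}"
        unfolding e using h(4) unfolding gA_def eqn .
    qed (use n(3,7,8) eqn in \<open>simp_all add: e\<close>)
    then show "c = c'" by simp
  qed
  have gpos: "1 \<le> gB c b \<and> 1 \<le> gA c b" if "(b, c) \<in> Gd" for b c
  proof -
    have ex: "\<exists>b'\<in>R c. b < b'" using that by (simp add: Gd_def)
    have n: "nx c b \<in> B" "b < nx c b" "nx c b + c \<in> A"
      using nx[OF ex] unfolding R_def by simp_all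
    have "nx c b \<in> {t \<in> B. b < t \<and> t \<le> nx c b}" "nx c b + c \<in> {t \<in> A. b + c < t \<and> t \<le> nx c b + c}"
      using n by auto
    then have ne: "{t \<in> B. b < t \<and> t \<le> nx c b} \<noteq> {}" "{t \<in> A. b + c < t \<and> t \<le> nx c b + c} \<noteq> {}" by blast+
    have "0 < gB c b" unfolding gB_def card_gt_0_iff using ne(1) fin(1) by simp
    moreover have "0 < gA c b" unfolding gA_def card_gt_0_iff using ne(2) finA by simp
    ultimately show ?thesis by linarith
  qed
  let ?NB = "{g::nat. 1 \<le> g \<and> real g \<le> real (card B) / s}"
  let ?NA = "{g::nat. 1 \<le> g \<and> real g \<le> real (card A) / s}"
  have finN: "finite {g::nat. 1 \<le> g \<and> real g \<le> z}" for z
  proof (rule finite_subset)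
    show "{g::nat. 1 \<le> g \<and> real g \<le> z} \<subseteq> {..nat \<lfloor>z\<rfloor>}" by (auto simp: le_nat_floor)
  qed simp
  have "card Gd = card ((\<lambda>(b, c). (b, gB c b, gA c b)) ` Gd)" by (simp add: card_image inj)
  also have "\<dots> \<le> card (B \<times> ?NB \<times> ?NA)"
  proof (rule card_mono)
    show "finite (B \<times> ?NB \<times> ?NA)" by (intro finite_cartesian_product fin finN)
    show "(\<lambda>(b, c). (b, gB c b, gA c b)) ` Gd \<subseteq> B \<times> ?NB \<times> ?NA"
    proof (rule image_subsetI)
      fix z assume z: "z \<in> Gd"
      define b c where "b = fst z" and "c = snd z"
      have zz: "z = (b, c)" by (simp add: b_def c_def)
      have h: "(b, c) \<in> Gd" using z zz by simp
      have m1: "b \<in> B" "real (gB c b) \<le> real (card B) / s" "real (gA c b) \<le> real (card A) / s"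
        using h unfolding Gd_def R_def by simp_all
      have m2: "1 \<le> gB c b" "1 \<le> gA c b" using gpos[OF h] by simp_all
      have "gB c b \<in> ?NB" "gA c b \<in> ?NA" using m1(2,3) m2 by simp_all
      then show "(\<lambda>(b, c). (b, gB c b, gA c b)) z \<in> B \<times> ?NB \<times> ?NA"
        unfolding zz prod.case using m1(1) by (intro SigmaI)
    qed
  qed
  finally have "real (card Gd) \<le> real (card (B \<times> ?NB \<times> ?NA))" by (simp only: of_nat_le_iff)
  also have "\<dots> = real (card B) * (real (card ?NB) * real (card ?NA))"
    by (simp only: card_cartesian_product of_nat_mult)
  also have "\<dots> \<le> real (card B) * ((real (card B) / s) * (real (card A) / s))"
    using s by (intro mult_left_mono mult_mono card_nat_real_le) auto
  finally have G: "real (card Gd) \<le> real (card B) * (real (card B) / s) * (real (card A) / s)" by (simp add: mult.assoc)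
  have finE: "finite {b. (b, c) \<in> Gd}" for c by (rule finite_subset[OF _ finR[of c]]) (auto simp: Gd_def)
  \<comment> \<open>Lost for each \<open>c\<close>: the largest representation, which has no
    successor, at most \<open>s\<close> with a large gap in \<open>B\<close>, and at most
    \<open>s\<close> with a large gap in \<open>A\<close>.\<close>
  have row: "real (card (R c)) \<le> 1 + 2 * s + real (card {b. (b, c) \<in> Gd})" if c: "c \<in> C" for c
  proof -
    define X where "X = {b \<in> R c. (\<exists>b'\<in>R c. b < b') \<and> real (card B) / s < real (card {t \<in> B. b + 0 < t \<and> t \<le> nx c b + 0})}"
    define Y where "Y = {b \<in> R c. (\<exists>b'\<in>R c. b < b') \<and> real (card A) / s < real (card {t \<in> A. b + c < t \<and> t \<le> nx c b + c})}"
    have X: "real (card X) \<le> s" unfolding X_def nx_def by (rule few_large_gaps[OF finR fin(1) s])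
    have Y: "real (card Y) \<le> s" unfolding Y_def nx_def by (rule few_large_gaps[OF finR finA s])
    have "R c \<subseteq> {Max (R c)} \<union> X \<union> Y \<union> {b. (b, c) \<in> Gd}"
    proof
      fix b assume b: "b \<in> R c"
      show "b \<in> {Max (R c)} \<union> X \<union> Y \<union> {b. (b, c) \<in> Gd}"
      proof (cases "\<exists>b'\<in>R c. b < b'")
        case True
        consider (x) "real (card B) / s < real (gB c b)" | (y) "real (card A) / s < real (gA c b)"
          | (g) "real (gB c b) \<le> real (card B) / s" "real (gA c b) \<le> real (card A) / s" by linarith
        then show ?thesis
        proof cases
          case x
          then have "b \<in> X" using b True unfolding X_def gB_def by simp
          then show ?thesis by simp
        next
          case y
          then have "b \<in> Y" using b True unfolding Y_def gA_def by simp
          then show ?thesis by simp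
        next
          case g
          then have "(b, c) \<in> Gd" using b c True unfolding Gd_def by simp
          then show ?thesis by simp
        qed
      next
        case False
        then have "b = Max (R c)" using b finR by (intro Max_eqI[symmetric]) auto
        then show ?thesis by simp
      qed
    qed
    then have "card (R c) \<le> card ({Max (R c)} \<union> X \<union> Y \<union> {b. (b, c) \<in> Gd})"
      using finR finE by (intro card_mono) (auto simp: X_def Y_def)
    also have "\<dots> \<le> 1 + card X + card Y + card {b. (b, c) \<in> Gd}"
      using card_Un_le[of "{Max (R c)} \<union> X \<union> Y" "{b. (b, c) \<in> Gd}"] card_Un_le[of "{Max (R c)} \<union> X" Y]
        card_Un_le[of "{Max (R c)}" X] by simp
    finally have "real (card (R c)) \<le> 1 + real (card X) + real (card Y) + real (card {b. (b, c) \<in> Gd})"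
      by linarith
    then show ?thesis using X Y by linarith
  qed
  have swap: "card (Sigma C F) = card {(b, c). c \<in> C \<and> b \<in> F c}" for F :: "real \<Rightarrow> real set"
  proof -
    have "{(b, c). c \<in> C \<and> b \<in> F c} = prod.swap ` Sigma C F" by force
    then show ?thesis by (simp add: card_image)
  qed
  have i1: "incid A B C = {(b, c). c \<in> C \<and> b \<in> R c}" by (auto simp: incid_def R_def)
  have i2: "{(b, c). c \<in> C \<and> b \<in> {b. (b, c) \<in> Gd}} = Gd" by (auto simp: Gd_def)
  have "real (card (incid A B C)) = real (card (Sigma C R))" unfolding i1 swap ..
  also have "\<dots> = (\<Sum>c\<in>C. real (card (R c)))" using fin finR by simp
  also have "\<dots> \<le> (\<Sum>c\<in>C. 1 + 2 * s + real (card {b. (b, c) \<in> Gd}))" by (intro sum_mono row)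
  also have "\<dots> = real (card C) * (1 + 2 * s) + (\<Sum>c\<in>C. real (card {b. (b, c) \<in> Gd}))"
    by (simp add: sum.distrib)
  also have "(\<Sum>c\<in>C. real (card {b. (b, c) \<in> Gd})) = real (card (Sigma C (\<lambda>c. {b. (b, c) \<in> Gd})))"
    using fin finE by simp
  also have "\<dots> = real (card Gd)" unfolding swap i2 ..
  finally show ?thesis using G by linarith
qed

text \<open>The cut \<open>s = W / c\<close> balances the two main terms of
  \<open>incid_le_param\<close>, where \<open>W\<close> is the cube root on the right. The leftover
  term \<open>c\<close> matters only if \<open>c > W\<close>; then \<open>c > n * b^2\<close>, and
  the trivial bound \<open>b * n\<close> is already below \<open>W\<close>.\<close>

lemma incid_le:
  assumes A: "convex_set A" and fin: "finite B" "finite C"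
  shows "real (card (incid A B C)) \<le> 4 * (real (card A) * real (card B)^2 * real (card C)^2) powr (1/3)"
proof (cases "card A = 0 \<or> card B = 0 \<or> card C = 0")
  case True
  then have "incid A B C = {}" using A fin by (auto simp: incid_def convex_set_def)
  then show ?thesis by simp
next
  case False
  define n b c where "n = real (card A)" and "b = real (card B)" and "c = real (card C)"
  have pos: "n \<ge> 1" "b \<ge> 1" "c \<ge> 1" using False by (auto simp: n_def b_def c_def)
  define W where "W = (n * b^2 * c^2) powr (1/3)"
  have W3: "W^3 = n * b^2 * c^2" using pos by (simp add: W_def powr_power)
  have Wpos: "W > 0" using pos by (simp add: W_def)
  define s where "s = W / c"
  have s: "s > 0" using pos Wpos by (simp add: s_def)
  have finA: "finite A" using A by (simp add: convex_set_def)
  have main: "real (card (incid A B C)) \<le> c * (1 + 2 * s) + b * (b / s) * (n / s)"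
    using incid_le_param[OF A fin s] by (simp add: n_def b_def c_def)
  have "b * (b / s) * (n / s) = W"
  proof -
    have "b * (b / s) * (n / s) = n * b^2 * c^2 / W^2"
      using pos Wpos by (simp add: s_def field_simps power2_eq_square)
    also have "\<dots> = W^3 / W^2" by (simp add: W3)
    also have "\<dots> = W" using Wpos by (simp add: power3_eq_cube power2_eq_square)
    finally show ?thesis .
  qed
  then have m2: "real (card (incid A B C)) \<le> c + 3 * W"
    using main pos by (simp add: s_def algebra_simps)
  show ?thesis
  proof (cases "c \<le> W")
    case True
    then show ?thesis using m2 by (simp add: W_def n_def b_def c_def)
  next
    case False
    then have "c^3 > n * b^2 * c^2" using W3 Wpos power_strict_mono[of W c 3] by simp
    then have "c > n * b^2" using pos by (simp add: power3_eq_cube power2_eq_square)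
    have "incid A B C \<subseteq> (\<lambda>(b, a). (b, a - b)) ` (B \<times> A)"
      by (force simp: incid_def image_iff)
    then have "card (incid A B C) \<le> card (B \<times> A)"
      using fin finA by (meson card_image_le card_mono finite_SigmaI finite_imageI le_trans)
    then have "real (card (incid A B C)) \<le> b * n"
      by (simp add: card_cartesian_product b_def n_def flip: of_nat_mult)
    also have "b * n \<le> W"
    proof (rule power_le_imp_le_base[of _ 2])
      have "(b * n)^3 = b^2 * n * (b * n^2)" by (simp add: power3_eq_cube power2_eq_square)
      also have "\<dots> \<le> b^2 * n * (c^2)"
      proof (rule mult_left_mono)
        have "b * n^2 \<le> (n * b^2)^2"
        proof -
          have "b \<le> b^4" using pos by (simp add: self_le_power)
          then show ?thesis using pos by (simp add: power_mult_distrib mult_left_mono mult.commute)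
        qed
        also have "\<dots> \<le> c^2" using \<open>c > n * b^2\<close> pos by (intro power_mono) auto
        finally show "b * n^2 \<le> c^2" .
      qed (use pos in auto)
      finally show "(b * n) ^ Suc 2 \<le> W ^ Suc 2" using W3 by (simp add: mult.commute mult.left_commute numeral_3_eq_3 del: power_Suc)
    qed (use Wpos in auto)
    finally show ?thesis using Wpos by (simp add: W_def n_def b_def c_def)
  qed
qed

text \<open>Dyadic decomposition of the weights. Level \<open>i\<close> holds at most
  \<open>2 powr (i + 1)\<close> points, and 2/3 is the exponent for which \<open>incid_le\<close>
  gives every pair of levels the same bound \<open>16 * card A powr (1/3)\<close>. There are
  \<open>(m + 1)^2\<close> pairs of levels up to \<open>m\<close>; the hypothesis on
  \<open>m\<close> makes all remaining pairs contribute at most 1.\<close>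

lemma weighted_incid:
  fixes m :: nat
  assumes A: "convex_set A" and fin: "finite B" "finite C"
    and pos: "\<And>b. b \<in> B \<Longrightarrow> 0 < \<beta> b" "\<And>c. c \<in> C \<Longrightarrow> 0 < \<gamma> c"
    and tot: "sum \<beta> B \<le> 1" "sum \<gamma> C \<le> 1"
    and m: "real (card B) * real (card C) \<le> 2 powr (2 * real m / 3)"
  shows "(\<Sum>(b, c)\<in>incid A B C. (\<beta> b * \<gamma> c) powr (2/3))
    \<le> 1 + 16 * (real m + 1)^2 * real (card A) powr (1/3)"
proof -
  define ix where "ix t = nat \<lfloor>- log 2 t\<rfloor>" for t :: real
  have ix: "t \<le> 2 powr (- real (ix t))" "2 powr (- (real (ix t) + 1)) < t" if "0 < t" "t \<le> 1" for t
  proof -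
    have l: "- log 2 t \<ge> 0" using that by (simp add: log_le_zero_cancel_iff)
    then have "real (ix t) \<le> - log 2 t" "- log 2 t < real (ix t) + 1"
      unfolding ix_def by linarith+
    then have a: "log 2 t \<le> - real (ix t)" "- (real (ix t) + 1) < log 2 t" by linarith+
    show "t \<le> 2 powr (- real (ix t))" using a(1) that by (subst (asm) log_le_iff) auto
    show "2 powr (- (real (ix t) + 1)) < t" using a(2) that by (subst (asm) less_log_iff) auto
  qed
  have le1: "\<beta> b \<le> 1" if "b \<in> B" for b
  proof -
    have "\<beta> b \<le> sum \<beta> B" by (rule member_le_sum[OF that]) (use pos(1) fin in \<open>auto intro: less_imp_le\<close>)
    then show ?thesis using tot by linarith
  qed
  have le1': "\<gamma> c \<le> 1" if "c \<in> C" for c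
  proof -
    have "\<gamma> c \<le> sum \<gamma> C" by (rule member_le_sum[OF that]) (use pos(2) fin in \<open>auto intro: less_imp_le\<close>)
    then show ?thesis using tot by linarith
  qed
  define Bi where "Bi i = {b \<in> B. ix (\<beta> b) = i}" for i
  define Ci where "Ci i = {c \<in> C. ix (\<gamma> c) = i}" for i
  have cardX: "real (card {b \<in> X. ix (\<delta> b) = i}) \<le> 2 powr (real i + 1)"
    if "finite X" "\<And>b. b \<in> X \<Longrightarrow> 0 < \<delta> b" "\<And>b. b \<in> X \<Longrightarrow> \<delta> b \<le> 1" "sum \<delta> X \<le> 1"
    for X :: "real set" and \<delta> i
  proof -
    let ?Y = "{b \<in> X. ix (\<delta> b) = i}"
    have "real (card ?Y) * 2 powr (- (real i + 1)) = (\<Sum>b\<in>?Y. 2 powr (- (real i + 1)))" by simp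
    also have "\<dots> \<le> (\<Sum>b\<in>?Y. \<delta> b)"
    proof (rule sum_mono)
      fix b assume "b \<in> ?Y"
      then show "2 powr (- (real i + 1)) \<le> \<delta> b" using ix(2)[of "\<delta> b"] that by auto
    qed
    also have "\<dots> \<le> sum \<delta> X" using that by (intro sum_mono2) (auto intro: less_imp_le)
    finally have "real (card ?Y) * 2 powr (- (real i + 1)) \<le> 1" using that by linarith
    then show ?thesis unfolding powr_minus by (simp add: field_simps)
  qed
  have cB: "real (card (Bi i)) \<le> 2 powr (real i + 1)" for i
    unfolding Bi_def using cardX[of B \<beta> i] fin pos le1 tot by blast
  have cC: "real (card (Ci i)) \<le> 2 powr (real i + 1)" for i
    unfolding Ci_def using cardX[of C \<gamma> i] fin pos le1' tot by blast
  define K where "K i j = (2 powr (- real i) * 2 powr (- real j)) powr (2/3)" for i j :: nat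
  have Kval: "K i j = 2 powr (- 2 * (real i + real j) / 3)" for i j
    by (simp add: K_def powr_powr field_simps flip: powr_add)
  have finI: "finite (incid A X Y)" if "finite X" "finite Y" for X Y
    by (rule finite_subset[of _ "X \<times> Y"]) (use that in \<open>auto simp: incid_def\<close>)
  have cell: "real (card (incid A (Bi i) (Ci j))) * K i j \<le> 16 * real (card A) powr (1/3)" for i j
  proof -
    have finBC: "finite (Bi i)" "finite (Ci j)" using fin by (auto simp: Bi_def Ci_def)
    have "real (card (incid A (Bi i) (Ci j)))
        \<le> 4 * (real (card A) * real (card (Bi i))^2 * real (card (Ci j))^2) powr (1/3)"
      by (rule incid_le[OF A finBC])
    also have "\<dots> \<le> 4 * (real (card A) * (2 powr (real i + 1))^2 * (2 powr (real j + 1))^2) powr (1/3)"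
      by (intro mult_left_mono powr_mono2 mult_mono power_mono cB cC) auto
    also have "(real (card A) * (2 powr (real i + 1))^2 * (2 powr (real j + 1))^2) powr (1/3)
        = real (card A) powr (1/3) * 2 powr ((2 * real i + 2 * real j + 4) / 3)"
      by (simp add: powr_mult powr_powr powr_power field_simps flip: powr_add)
    finally have "real (card (incid A (Bi i) (Ci j))) * K i j
        \<le> 4 * (real (card A) powr (1/3) * 2 powr ((2 * real i + 2 * real j + 4) / 3)) * K i j"
      by (intro mult_right_mono) (auto simp: K_def)
    also have "\<dots> = 4 * real (card A) powr (1/3) * (2 powr ((2 * real i + 2 * real j + 4) / 3) * 2 powr (- 2 * (real i + real j) / 3))"
      by (simp add: Kval)
    also have "2 powr ((2 * real i + 2 * real j + 4) / 3) * 2 powr (- 2 * (real i + real j) / 3) = 2 powr (4/3)"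
      unfolding powr_add[symmetric] by (rule arg_cong[where f = "(powr) 2"]) (simp add: field_simps)
    also have "2 powr (4/3) \<le> (4::real)" using powr_mono[of "4/3" 2 "2::real"] by simp
    finally show ?thesis by (simp add: mult_left_mono)
  qed
  \<comment> \<open>Bounds the weight of any pair with at least one level above
    \<open>m\<close>.\<close>
  define T where "T = 2 powr (- 2 * real m / 3)"
  have trm: "(\<beta> b * \<gamma> c) powr (2/3) \<le> (\<Sum>i\<le>m. \<Sum>j\<le>m. if b \<in> Bi i \<and> c \<in> Ci j then K i j else 0) + T"
    (is "?l \<le> ?S + T") if bc: "b \<in> B" "c \<in> C" for b c
  proof -
    have b: "0 < \<beta> b" "\<beta> b \<le> 1" and c: "0 < \<gamma> c" "\<gamma> c \<le> 1" using bc pos le1 le1' by auto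
    have S0: "?S \<ge> 0" by (intro sum_nonneg) (auto simp: K_def)
    let ?i = "ix (\<beta> b)" and ?j = "ix (\<gamma> c)"
    have bound: "?l \<le> K ?i ?j" unfolding K_def
      using ix(1)[OF b] ix(1)[OF c] b c by (intro powr_mono2 mult_mono) auto
    show ?thesis
    proof (cases "?i \<le> m \<and> ?j \<le> m")
      case True
      have "K ?i ?j = (\<Sum>j\<le>m. if b \<in> Bi ?i \<and> c \<in> Ci j then K ?i j else 0)"
        using True bc by (subst sum.remove[of _ ?j]) (auto simp: Bi_def Ci_def)
      also have "\<dots> \<le> ?S"
        using True by (intro member_le_sum[of ?i "{..m}" "\<lambda>i. \<Sum>j\<le>m. if b \<in> Bi i \<and> c \<in> Ci j then K i j else 0"])
          (auto intro!: sum_nonneg simp: K_def)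
      finally show ?thesis using bound by (simp add: T_def add_increasing2)
    next
      case False
      then have "K ?i ?j \<le> T" unfolding Kval T_def by (intro powr_mono) (auto simp: field_simps)
      then show ?thesis using bound S0 by linarith
    qed
  qed
  let ?X = "\<Sum>(b, c)\<in>incid A B C. (\<Sum>i\<le>m. \<Sum>j\<le>m. if b \<in> Bi i \<and> c \<in> Ci j then K i j else 0) + T"
  let ?S1 = "\<Sum>i\<le>m. \<Sum>j\<le>m. \<Sum>(b, c)\<in>incid A B C. if b \<in> Bi i \<and> c \<in> Ci j then K i j else 0"
  let ?S2 = "\<Sum>i\<le>m. \<Sum>j\<le>m. real (card (incid A (Bi i) (Ci j))) * K i j"
  have e1: "(\<Sum>(b, c)\<in>incid A B C. (\<beta> b * \<gamma> c) powr (2/3))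
      \<le> (\<Sum>(b, c)\<in>incid A B C. (\<Sum>i\<le>m. \<Sum>j\<le>m. if b \<in> Bi i \<and> c \<in> Ci j then K i j else 0) + T)"
    by (rule sum_mono) (auto simp: incid_def intro!: trm)
  have e2: "?X = (\<Sum>i\<le>m. \<Sum>j\<le>m. \<Sum>(b, c)\<in>incid A B C. if b \<in> Bi i \<and> c \<in> Ci j then K i j else 0)
      + real (card (incid A B C)) * T"
  proof -
    let ?G = "\<lambda>i j z. if fst z \<in> Bi i \<and> snd z \<in> Ci j then K i j else 0"
    have "(\<Sum>z\<in>incid A B C. \<Sum>i\<le>m. \<Sum>j\<le>m. ?G i j z) = (\<Sum>i\<le>m. \<Sum>z\<in>incid A B C. \<Sum>j\<le>m. ?G i j z)"
      by (rule sum.swap)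
    also have "\<dots> = (\<Sum>i\<le>m. \<Sum>j\<le>m. \<Sum>z\<in>incid A B C. ?G i j z)"
      by (rule sum.cong[OF refl], rule sum.swap)
    finally show ?thesis by (simp only: case_prod_unfold sum.distrib sum_constant of_nat_mult)
  qed
  have e3: "(\<Sum>i\<le>m. \<Sum>j\<le>m. \<Sum>(b, c)\<in>incid A B C. if b \<in> Bi i \<and> c \<in> Ci j then K i j else 0)
      = (\<Sum>i\<le>m. \<Sum>j\<le>m. real (card (incid A (Bi i) (Ci j))) * K i j)"
  proof (intro sum.cong refl)
    fix i j
    have "(\<Sum>(b, c)\<in>incid A B C. if b \<in> Bi i \<and> c \<in> Ci j then K i j else 0)
        = (\<Sum>z\<in>incid A B C. if z \<in> incid A (Bi i) (Ci j) then K i j else 0)"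
      by (rule sum.cong[OF refl]) (auto simp: incid_def split: if_splits)
    also have "\<dots> = (\<Sum>z\<in>incid A B C \<inter> incid A (Bi i) (Ci j). K i j)"
      by (rule sum.inter_restrict[OF finI[OF fin], symmetric])
    also have "incid A B C \<inter> incid A (Bi i) (Ci j) = incid A (Bi i) (Ci j)"
      by (auto simp: incid_def Bi_def Ci_def)
    finally show "(\<Sum>(b, c)\<in>incid A B C. if b \<in> Bi i \<and> c \<in> Ci j then K i j else 0)
        = real (card (incid A (Bi i) (Ci j))) * K i j" by simp
  qed
  have e4: "?S2 \<le> (\<Sum>i\<le>m. \<Sum>j\<le>m. 16 * real (card A) powr (1/3))" by (intro sum_mono cell)
  have e5: "(\<Sum>i\<le>m. \<Sum>j\<le>m. 16 * real (card A) powr (1/3)) = 16 * (real m + 1)^2 * real (card A) powr (1/3)"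
    by (simp add: power2_eq_square algebra_simps)
  have main: "(\<Sum>(b, c)\<in>incid A B C. (\<beta> b * \<gamma> c) powr (2/3))
      \<le> 16 * (real m + 1)^2 * real (card A) powr (1/3) + real (card (incid A B C)) * T"
    using e1 e4 unfolding e2 e3 e5 by linarith
  have "card (incid A B C) \<le> card (B \<times> C)" using fin by (intro card_mono) (auto simp: incid_def)
  then have "real (card (incid A B C)) \<le> real (card (B \<times> C))" by (simp only: of_nat_le_iff)
  then have "real (card (incid A B C)) \<le> real (card B) * real (card C)"
    by (simp only: card_cartesian_product of_nat_mult)
  then have "real (card (incid A B C)) * T \<le> 2 powr (2 * real m / 3) * T"
    using m by (intro mult_right_mono) (auto simp: T_def)
  also have "\<dots> = 1" by (simp add: T_def flip: powr_add)
  finally show ?thesis using main by linarith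
qed

section \<open>Entropy of finitely supported laws\<close>


text \<open>Shannon entropy in nats, as the expected surprisal. All variables live on one law
  \<open>p\<close>, so a joint entropy is the entropy of a tuple.\<close>

definition ent :: "'s pmf \<Rightarrow> ('s \<Rightarrow> 'b) \<Rightarrow> real" where
  "ent p f = measure_pmf.expectation p (\<lambda>s. - ln (pmf (map_pmf f p) (f s)))"

text \<open>Almost sure functional dependence without naming the function: each instance becomes a
  goal about tuples in the support, where linear relations between the coordinates are
  available.\<close>

definition det :: "'s pmf \<Rightarrow> ('s \<Rightarrow> 'b) \<Rightarrow> ('s \<Rightarrow> 'c) \<Rightarrow> bool" where
  "det p X Z \<longleftrightarrow> (\<forall>s\<in>set_pmf p. \<forall>t\<in>set_pmf p. X s = X t \<longrightarrow> Z s = Z t)"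

lemma ent_map: "ent (map_pmf g p) f = ent p (\<lambda>s. f (g s))"
  by (simp add: ent_def map_pmf_comp integral_map_pmf)

lemma ent_sum:
  "finite (set_pmf p) \<Longrightarrow> ent p f = (\<Sum>s\<in>set_pmf p. - ln (pmf (map_pmf f p) (f s)) * pmf p s)"
  unfolding ent_def by (rule integral_measure_pmf_real) auto

lemma pmf_map_pos: "s \<in> set_pmf p \<Longrightarrow> 0 < pmf (map_pmf f p) (f s)"
  by (simp add: pmf_positive)

lemma ent_mono:
  assumes fin: "finite (set_pmf p)" and d: "det p X Z"
  shows "ent p Z \<le> ent p X"
  unfolding ent_sum[OF fin]
proof (rule sum_mono)
  fix s assume s: "s \<in> set_pmf p"
  have "pmf (map_pmf X p) (X s) \<le> pmf (map_pmf Z p) (Z s)"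
  proof -
    have "\<forall>t\<in>set_pmf p. t \<in> X -` {X s} \<longrightarrow> t \<in> Z -` {Z s}"
    proof (intro ballI impI)
      fix t assume t: "t \<in> set_pmf p" "t \<in> X -` {X s}"
      then have "X t = X s" by simp
      then have "Z t = Z s" using d t(1) s unfolding det_def by blast
      then show "t \<in> Z -` {Z s}" by simp
    qed
    then have "AE t in measure_pmf p. t \<in> X -` {X s} \<longrightarrow> t \<in> Z -` {Z s}" by (simp only: AE_measure_pmf_iff)
    then show ?thesis unfolding pmf_map by (rule measure_pmf.finite_measure_mono_AE) simp
  qed
  then show "- ln (pmf (map_pmf Z p) (Z s)) * pmf p s \<le> - ln (pmf (map_pmf X p) (X s)) * pmf p s"
    using pmf_map_pos[OF s, of X] pmf_map_pos[OF s, of Z] by (intro mult_right_mono) (simp_all add: ln_mono)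
qed

lemma ent_cong: "finite (set_pmf p) \<Longrightarrow> det p X Z \<Longrightarrow> det p Z X \<Longrightarrow> ent p Z = ent p X"
  by (simp add: antisym ent_mono)

lemma det_factor:
  assumes "det p X Z" obtains \<phi> where "\<And>s. s \<in> set_pmf p \<Longrightarrow> Z s = \<phi> (X s)"
proof
  fix s assume s: "s \<in> set_pmf p"
  define t where "t = (SOME t. t \<in> set_pmf p \<and> X t = X s)"
  have "t \<in> set_pmf p \<and> X t = X s" unfolding t_def by (rule someI[of _ s]) (simp add: s)
  then show "Z s = (\<lambda>x. Z (SOME t. t \<in> set_pmf p \<and> X t = x)) (X s)"
    using assms s unfolding det_def t_def by metis
qed

lemma expectation_sum:
  fixes f :: "'s \<Rightarrow> real"
  shows "finite (set_pmf p) \<Longrightarrow> measure_pmf.expectation p f = (\<Sum>s\<in>set_pmf p. f s * pmf p s)"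
  by (rule integral_measure_pmf_real) auto

text \<open>This is nonnegativity of the mutual information of \<open>X\<close> and \<open>Y\<close>
  given their common function \<open>Z\<close>. By Gibbs' argument, \<open>r\<close> compares the
  conditionally independent coupling with the joint law; its mean is at most 1, and
  \<open>ln r \<le> r - 1\<close>.\<close>

lemma ent_submod_pair:
  assumes fin: "finite (set_pmf p)" and X: "det p X Z" and Y: "det p Y Z"
  shows "ent p (\<lambda>s. (X s, Y s)) + ent p Z \<le> ent p X + ent p Y"
proof -
  obtain \<phi> where \<phi>: "\<And>s. s \<in> set_pmf p \<Longrightarrow> Z s = \<phi> (X s)" using det_factor[OF X] by blast
  obtain \<psi> where \<psi>: "\<And>s. s \<in> set_pmf p \<Longrightarrow> Z s = \<psi> (Y s)" using det_factor[OF Y] by blast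
  define PX PY PZ PJ where "PX = map_pmf X p" and "PY = map_pmf Y p" and "PZ = map_pmf Z p"
    and "PJ = map_pmf (\<lambda>s. (X s, Y s)) p"
  define r where "r s = pmf PX (X s) * pmf PY (Y s) / (pmf PJ (X s, Y s) * pmf PZ (Z s))" for s
  have pos: "0 < pmf PX (X s)" "0 < pmf PY (Y s)" "0 < pmf PZ (Z s)" "0 < pmf PJ (X s, Y s)"
    if "s \<in> set_pmf p" for s
    using that by (auto simp: PX_def PY_def PZ_def PJ_def intro!: pmf_positive)
  have finJ: "finite (set_pmf PJ)" "finite (set_pmf PX)" "finite (set_pmf PY)"
    using fin by (auto simp: PJ_def PX_def PY_def)
  have PZ1: "map_pmf \<psi> PY = PZ" unfolding PY_def PZ_def map_pmf_comp
    by (rule map_pmf_cong) (auto simp: \<psi>)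
  have "measure_pmf.expectation p r = measure_pmf.expectation p (\<lambda>s. (\<lambda>(x, y). pmf PX x * pmf PY y / (pmf PJ (x, y) * pmf PZ (\<phi> x))) (X s, Y s))"
    unfolding expectation_sum[OF fin] by (rule sum.cong) (auto simp: r_def \<phi>)
  also have "\<dots> = measure_pmf.expectation PJ (\<lambda>(x, y). pmf PX x * pmf PY y / (pmf PJ (x, y) * pmf PZ (\<phi> x)))"
    by (simp add: PJ_def integral_map_pmf)
  also have "\<dots> = (\<Sum>(x, y)\<in>set_pmf PJ. pmf PX x * pmf PY y / pmf PZ (\<phi> x))"
    unfolding expectation_sum[OF finJ(1)] by (rule sum.cong) (auto simp: set_pmf_eq)
  \<comment> \<open>The support of the joint law is enlarged to all pairs with the same value of
    \<open>Z\<close>, over which the conditional product weights sum to 1.\<close>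
  also have "\<dots> \<le> (\<Sum>(x, y)\<in>Sigma (set_pmf PX) (\<lambda>x. {y \<in> set_pmf PY. \<psi> y = \<phi> x}). pmf PX x * pmf PY y / pmf PZ (\<phi> x))"
  proof (rule sum_mono2)
    show "set_pmf PJ \<subseteq> Sigma (set_pmf PX) (\<lambda>x. {y \<in> set_pmf PY. \<psi> y = \<phi> x})"
      using \<phi> \<psi> by (auto simp: PJ_def PX_def PY_def)
  qed (use finJ in auto)
  also have "\<dots> = (\<Sum>x\<in>set_pmf PX. \<Sum>y\<in>{y \<in> set_pmf PY. \<psi> y = \<phi> x}. pmf PX x * pmf PY y / pmf PZ (\<phi> x))"
    using finJ by (subst sum.Sigma) auto
  also have "\<dots> = (\<Sum>x\<in>set_pmf PX. pmf PX x)"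
  proof (rule sum.cong)
    fix x assume x: "x \<in> set_pmf PX"
    then obtain s where s: "s \<in> set_pmf p" "x = X s" by (auto simp: PX_def)
    have "(\<Sum>y\<in>{y \<in> set_pmf PY. \<psi> y = \<phi> x}. pmf PY y) = pmf PZ (\<phi> x)"
    proof -
      have "pmf PZ (\<phi> x) = measure PY (\<psi> -` {\<phi> x})" unfolding PZ1[symmetric] by (simp add: pmf_map)
      also have "\<dots> = measure PY {y \<in> set_pmf PY. \<psi> y = \<phi> x}"
        by (intro measure_pmf.finite_measure_eq_AE) (auto simp: AE_measure_pmf_iff)
      also have "\<dots> = (\<Sum>y\<in>{y \<in> set_pmf PY. \<psi> y = \<phi> x}. pmf PY y)"
        using finJ by (intro measure_measure_pmf_finite) auto
      finally show ?thesis by simp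
    qed
    moreover have "0 < pmf PZ (\<phi> x)" using pos(3)[OF s(1)] \<phi>[OF s(1)] s by simp
    ultimately show "(\<Sum>y\<in>{y \<in> set_pmf PY. \<psi> y = \<phi> x}. pmf PX x * pmf PY y / pmf PZ (\<phi> x)) = pmf PX x"
      by (simp flip: sum_divide_distrib sum_distrib_left)
  qed simp
  also have "\<dots> = 1" using finJ by (intro sum_pmf_eq_1) auto
  finally have r1: "(\<Sum>s\<in>set_pmf p. r s * pmf p s) \<le> 1" by (simp add: expectation_sum[OF fin])
  have one: "(\<Sum>s\<in>set_pmf p. pmf p s) = 1" using fin by (intro sum_pmf_eq_1) auto
  have "ent p (\<lambda>s. (X s, Y s)) + ent p Z - ent p X - ent p Y
      = (\<Sum>s\<in>set_pmf p. (ln (pmf PX (X s)) + ln (pmf PY (Y s)) - ln (pmf PJ (X s, Y s)) - ln (pmf PZ (Z s))) * pmf p s)"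
    unfolding ent_sum[OF fin] PX_def PY_def PZ_def PJ_def
    by (simp add: algebra_simps sum.distrib sum_subtractf sum_negf)
  also have "\<dots> \<le> (\<Sum>s\<in>set_pmf p. (r s - 1) * pmf p s)"
  proof (rule sum_mono, rule mult_right_mono)
    fix s assume s: "s \<in> set_pmf p"
    have "ln (r s) \<le> r s - 1" using pos[OF s] by (intro ln_le_minus_one) (auto simp: r_def)
    then show "ln (pmf PX (X s)) + ln (pmf PY (Y s)) - ln (pmf PJ (X s, Y s)) - ln (pmf PZ (Z s)) \<le> r s - 1"
      using pos[OF s] by (simp add: r_def ln_div ln_mult)
  qed simp
  also have "\<dots> \<le> 0" using r1 one by (simp add: algebra_simps sum_subtractf)
  finally show ?thesis by simp
qed

lemma ent_submod:
  assumes fin: "finite (set_pmf p)" and "det p X Z" "det p Y Z" and W: "det p (\<lambda>s. (X s, Y s)) W"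
  shows "ent p W + ent p Z \<le> ent p X + ent p Y"
  using ent_submod_pair[OF fin, of X Z Y] ent_mono[OF fin W] assms by linarith

lemma ent_const [simp]: "ent p (\<lambda>_. k) = 0"
  by (simp add: ent_def)

lemma ent_nonneg: "finite (set_pmf p) \<Longrightarrow> 0 \<le> ent p X"
  using ent_mono[of p X "\<lambda>_. ()"] by (simp add: det_def)

lemma ent_le_card:
  assumes fin: "finite (set_pmf p)" and S: "finite S" "\<And>s. s \<in> set_pmf p \<Longrightarrow> X s \<in> S"
  shows "ent p X \<le> ln (real (card S))"
proof -
  define q where "q = map_pmf X p"
  have finq: "finite (set_pmf q)" using fin by (simp add: q_def)
  have sub: "set_pmf q \<subseteq> S" using S by (auto simp: q_def)
  have c: "0 < real (card S)" using S sub set_pmf_not_empty[of q] by (auto simp: card_gt_0_iff)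
  have one: "(\<Sum>s\<in>set_pmf q. pmf q s) = 1" using finq by (intro sum_pmf_eq_1) auto
  have "ent p X = ent q (\<lambda>x. x)" by (simp add: q_def ent_map)
  also have "\<dots> - ln (real (card S)) = (\<Sum>s\<in>set_pmf q. (- ln (pmf q s) - ln (real (card S))) * pmf q s)"
  proof -
    have "(\<Sum>s\<in>set_pmf q. pmf q s * ln (real (card S))) = ln (real (card S))"
      by (simp add: one flip: sum_distrib_right)
    then show ?thesis unfolding ent_sum[OF finq] by (simp add: algebra_simps sum_subtractf sum.distrib sum_negf)
  qed
  also have "\<dots> \<le> (\<Sum>s\<in>set_pmf q. 1 / real (card S) - pmf q s)"
  proof (rule sum_mono)
    fix s assume s: "s \<in> set_pmf q"
    have p: "0 < pmf q s" using s by (rule pmf_positive)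
    have "ln (1 / (real (card S) * pmf q s)) \<le> 1 / (real (card S) * pmf q s) - 1"
      using c p by (intro ln_le_minus_one) auto
    then have "(- ln (pmf q s) - ln (real (card S))) * pmf q s \<le> (1 / (real (card S) * pmf q s) - 1) * pmf q s"
      using c p by (intro mult_right_mono) (auto simp: ln_div ln_mult)
    also have "(1 / (real (card S) * pmf q s) - 1) * pmf q s = 1 / real (card S) - pmf q s"
      using c p by (simp add: field_simps)
    finally show "(- ln (pmf q s) - ln (real (card S))) * pmf q s \<le> 1 / real (card S) - pmf q s" .
  qed
  also have "\<dots> = real (card (set_pmf q)) / real (card S) - 1" using one by (simp add: sum_subtractf)
  also have "\<dots> \<le> 0" using c card_mono[OF S(1) sub] by (simp add: field_simps)
  finally show ?thesis by simp
qed

lemma ent_uniform: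
  assumes "finite S" "S \<noteq> {}"
  shows "ent (pmf_of_set S) (\<lambda>s. s) = ln (real (card S))"
proof -
  have "ent (pmf_of_set S) (\<lambda>s. s) = (\<Sum>s\<in>S. - ln (1 / real (card S)) * (1 / real (card S)))"
    using assms by (subst ent_sum) (auto intro!: sum.cong)
  then show ?thesis using assms by (simp add: ln_div card_gt_0_iff)
qed

text \<open>The conditionally independent coupling of two laws over a common marginal.\<close>
definition glue :: "'a pmf \<Rightarrow> ('a \<Rightarrow> 'c) \<Rightarrow> 'b pmf \<Rightarrow> ('b \<Rightarrow> 'c) \<Rightarrow> ('a \<times> 'b) pmf" where
  "glue p f q g = bind_pmf p (\<lambda>x. map_pmf (Pair x) (cond_pmf q {y. g y = f x}))"

context
  fixes p :: "'a pmf" and q :: "'b pmf" and f :: "'a \<Rightarrow> 'c" and g :: "'b \<Rightarrow> 'c"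
  assumes eq: "map_pmf f p = map_pmf g q" and fin: "finite (set_pmf p)" "finite (set_pmf q)"
begin

lemma glue_ne: "x \<in> set_pmf p \<Longrightarrow> set_pmf q \<inter> {y. g y = f x} \<noteq> {}"
proof -
  assume "x \<in> set_pmf p"
  then have "f x \<in> set_pmf (map_pmf g q)" unfolding eq[symmetric] by simp
  then show ?thesis by auto
qed

lemma fst_glue: "map_pmf fst (glue p f q g) = p"
  by (simp add: glue_def map_bind_pmf map_pmf_comp map_pmf_const bind_return_pmf')

lemma set_glue: "set_pmf (glue p f q g) = {(x, y). x \<in> set_pmf p \<and> y \<in> set_pmf q \<and> f x = g y}"
  using glue_ne by (auto simp: glue_def set_cond_pmf)

lemma snd_glue: "map_pmf snd (glue p f q g) = q"
proof -
  have "map_pmf snd (glue p f q g) = bind_pmf p (\<lambda>x. cond_pmf q {y. g y = f x})"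
    by (simp add: glue_def map_bind_pmf map_pmf_comp)
  also have "\<dots> = bind_pmf (map_pmf f p) (\<lambda>v. cond_pmf q {y. g y = v})" by (simp add: bind_map_pmf)
  also have "\<dots> = bind_pmf (map_pmf g q) (\<lambda>v. cond_pmf q {y. g y = v})" by (simp add: eq)
  also have "\<dots> = bind_pmf q (\<lambda>x. cond_pmf q {y. g y = g x})" by (simp add: bind_map_pmf)
  also have "\<dots> = q"
    by (rule bind_cond_pmf_cancel) (auto intro!: arg_cong[where f = "measure _"])
  finally show ?thesis .
qed

lemma pmf_glue:
  assumes x: "x \<in> set_pmf p" and y: "y \<in> set_pmf q" and xy: "f x = g y"
  shows "pmf (glue p f q g) (x, y) = pmf p x * pmf q y / pmf (map_pmf f p) (f x)"
proof -
  have "pmf (glue p f q g) (x, y) = (\<Sum>a\<in>{x}. pmf (map_pmf (Pair a) (cond_pmf q {y. g y = f a})) (x, y) * pmf p a)"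
    unfolding glue_def pmf_bind
    by (rule integral_measure_pmf_real) (auto simp: pmf_eq_0_set_pmf)
  also have "\<dots> = pmf (map_pmf (Pair x) (cond_pmf q {y. g y = f x})) (x, y) * pmf p x" by simp
  also have "pmf (map_pmf (Pair x) (cond_pmf q {y. g y = f x})) (x, y) = pmf (cond_pmf q {y. g y = f x}) y"
    by (rule pmf_map_inj') (auto simp: inj_def)
  also have "\<dots> = pmf q y / measure q {y. g y = f x}" using glue_ne[OF x] xy by (simp add: pmf_cond)
  also have "measure q {y. g y = f x} = pmf (map_pmf f p) (f x)"
    unfolding eq by (simp add: pmf_map vimage_def)
  finally show ?thesis by simp
qed

lemma finite_glue: "finite (set_pmf (glue p f q g))"
  unfolding set_glue by (rule finite_subset[of _ "set_pmf p \<times> set_pmf q"]) (auto simp: fin)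

lemma card_glue: "card (set_pmf (glue p f q g)) \<le> card (set_pmf p) * card (set_pmf q)"
  unfolding set_glue card_cartesian_product[symmetric] by (rule card_mono) (auto simp: fin)

text \<open>Conditional independence turns submodularity into an equality. This is the source of
  lower bounds for joint entropies in everything that follows.\<close>

lemma ent_glue: "ent (glue p f q g) (\<lambda>s. s) = ent p (\<lambda>x. x) + ent q (\<lambda>y. y) - ent p f"
proof -
  let ?r = "glue p f q g"
  have e: "ent p F = (\<Sum>s\<in>set_pmf ?r. - ln (pmf (map_pmf F p) (F (fst s))) * pmf ?r s)" for F :: "'a \<Rightarrow> 'd"
    using ent_map[of fst ?r F] ent_sum[OF finite_glue, of "\<lambda>s. F (fst s)"] fst_glue
    by (simp add: map_pmf_comp[symmetric, of F fst])
  have e2: "ent q (\<lambda>y. y) = (\<Sum>s\<in>set_pmf ?r. - ln (pmf q (snd s)) * pmf ?r s)"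
    using ent_map[of snd ?r "\<lambda>y. y"] ent_sum[OF finite_glue, of snd] by (simp add: snd_glue)
  have "ent ?r (\<lambda>s. s) = (\<Sum>s\<in>set_pmf ?r. - ln (pmf ?r s) * pmf ?r s)"
    by (simp add: ent_sum[OF finite_glue])
  also have "\<dots> = (\<Sum>s\<in>set_pmf ?r. (- ln (pmf p (fst s)) - ln (pmf q (snd s)) + ln (pmf (map_pmf f p) (f (fst s)))) * pmf ?r s)"
  proof (intro sum.cong refl arg_cong2[where f = "(*)"])
    fix s assume "s \<in> set_pmf ?r"
    then obtain x y where s: "s = (x, y)" "x \<in> set_pmf p" "y \<in> set_pmf q" "f x = g y"
      by (auto simp: set_glue)
    have "0 < pmf p x" "0 < pmf q y" "0 < pmf (map_pmf f p) (f x)"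
      using s(2,3) by (auto intro!: pmf_positive)
    then show "- ln (pmf ?r s) = - ln (pmf p (fst s)) - ln (pmf q (snd s)) + ln (pmf (map_pmf f p) (f (fst s)))"
      using s by (simp add: pmf_glue ln_div ln_mult)
  qed
  also have "\<dots> = ent p (\<lambda>x. x) + ent q (\<lambda>y. y) - ent p f"
    unfolding e e2 by (simp add: algebra_simps sum.distrib sum_subtractf sum_negf)
  finally show ?thesis .
qed
end


section \<open>Control in entropy form\<close>

lemma sum_pmf_fibre:
  assumes "finite (set_pmf P)"
  shows "(\<Sum>b\<in>{b. (z, b) \<in> set_pmf P}. pmf P (z, b)) = pmf (map_pmf fst P) z"
proof -
  have "pmf (map_pmf fst P) z = measure P (fst -` {z})" by (simp add: pmf_map)
  also have "\<dots> = measure P (Pair z ` {b. (z, b) \<in> set_pmf P})"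
    by (intro measure_pmf.finite_measure_eq_AE) (auto simp: AE_measure_pmf_iff)
  also have "\<dots> = (\<Sum>w\<in>Pair z ` {b. (z, b) \<in> set_pmf P}. pmf P w)"
    by (intro measure_measure_pmf_finite finite_subset[OF _ assms]) auto
  also have "\<dots> = (\<Sum>b\<in>{b. (z, b) \<in> set_pmf P}. pmf P (z, b))"
    by (subst sum.reindex) (auto simp: inj_on_def)
  finally show ?thesis by simp
qed

text \<open>Given \<open>Z = z\<close>, the pair of values lies in an incidence set, and
  \<open>weighted_incid\<close> applies to the conditional masses of \<beta> and \<gamma>. Averaging
  over \<open>z\<close> bounds the mean of \<open>t\<close> by \<Lambda>, and concavity of
  \<open>ln\<close> turns that into entropies. The lone \<open>ent p Z\<close> on the left is what
  remains of the conditional entropies: four copies from the right minus three from the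
  left.\<close>

lemma ent_control_aux:
  fixes p :: "'s pmf" and \<beta> \<gamma> :: "'s \<Rightarrow> real" and Z :: "'s \<Rightarrow> 'z"
  assumes A: "convex_set A" and fin: "finite (set_pmf p)"
    and mem: "\<And>s. s \<in> set_pmf p \<Longrightarrow> \<beta> s + \<gamma> s \<in> A"
    and m: "real (card (set_pmf p))^2 \<le> 2 powr (2 * real m / 3)"
  shows "3 * ent p (\<lambda>s. (Z s, \<beta> s, \<gamma> s)) + ent p Z \<le> 2 * ent p (\<lambda>s. (Z s, \<beta> s)) + 2 * ent p (\<lambda>s. (Z s, \<gamma> s))
     + 3 * ln (1 + 16 * (real m + 1)^2 * real (card A) powr (1/3))"
proof -
  define \<Lambda> where "\<Lambda> = 1 + 16 * (real m + 1)^2 * real (card A) powr (1/3)"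
  have \<Lambda>: "\<Lambda> > 0" unfolding \<Lambda>_def by (rule add_pos_nonneg) auto
  define P1 P2 PZ PW where "P1 = map_pmf (\<lambda>s. (Z s, \<beta> s)) p" and "P2 = map_pmf (\<lambda>s. (Z s, \<gamma> s)) p"
    and "PZ = map_pmf Z p" and "PW = map_pmf (\<lambda>s. (Z s, \<beta> s, \<gamma> s)) p"
  have fins: "finite (set_pmf P1)" "finite (set_pmf P2)" "finite (set_pmf PZ)" "finite (set_pmf PW)"
    using fin by (auto simp: P1_def P2_def PZ_def PW_def)
  have pos: "0 < pmf P1 (Z s, \<beta> s)" "0 < pmf P2 (Z s, \<gamma> s)" "0 < pmf PZ (Z s)" "0 < pmf PW (Z s, \<beta> s, \<gamma> s)"
    if "s \<in> set_pmf p" for s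
    using that by (auto simp: P1_def P2_def PZ_def PW_def intro!: pmf_positive)
  define h where "h = (\<lambda>(z, b, c). (pmf P1 (z, b) * pmf P2 (z, c)) powr (2/3) / pmf PZ z powr (1/3))"
  define t where "t s = h (Z s, \<beta> s, \<gamma> s) / pmf PW (Z s, \<beta> s, \<gamma> s)" for s
  define B where "B z = {b. (z, b) \<in> set_pmf P1}" for z
  define C where "C z = {c. (z, c) \<in> set_pmf P2}" for z
  define F where "F z = {(b, c). (z, b, c) \<in> set_pmf PW}" for z
  have Bsub: "B z \<subseteq> \<beta> ` set_pmf p" and Csub: "C z \<subseteq> \<gamma> ` set_pmf p" for z
    by (auto simp: B_def C_def P1_def P2_def)
  have finBC: "finite (B z)" "finite (C z)" for z using Bsub Csub fin by (meson finite_imageI finite_subset)+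
  have Fsub: "F z \<subseteq> incid A (B z) (C z)" for z
    using mem by (auto simp: F_def B_def C_def incid_def PW_def P1_def P2_def image_iff)
  have finI: "finite (incid A (B z) (C z))" for z
    by (rule finite_subset[of _ "B z \<times> C z"]) (use finBC in \<open>auto simp: incid_def\<close>)
  have finF: "finite (F z)" for z using Fsub finI finite_subset by blast
  have PZ1: "map_pmf fst P1 = PZ" "map_pmf fst P2 = PZ" by (simp_all add: P1_def P2_def PZ_def map_pmf_comp)
  have fibre: "(\<Sum>w\<in>F z. h (z, w)) \<le> pmf PZ z * \<Lambda>" if z: "z \<in> set_pmf PZ" for z
  proof -
    have pz: "0 < pmf PZ z" using z by (rule pmf_positive)
    have s1: "(\<Sum>b\<in>B z. pmf P1 (z, b) / pmf PZ z) = 1" "(\<Sum>c\<in>C z. pmf P2 (z, c) / pmf PZ z) = 1"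
      using sum_pmf_fibre[OF fins(1), of z] sum_pmf_fibre[OF fins(2), of z] pz PZ1
      by (simp_all add: B_def C_def flip: sum_divide_distrib)
    have "real (card (B z)) \<le> real (card (set_pmf p))" "real (card (C z)) \<le> real (card (set_pmf p))"
      using Bsub Csub fin by (meson card_image_le card_mono finite_imageI le_trans of_nat_le_iff)+
    then have "real (card (B z)) * real (card (C z)) \<le> real (card (set_pmf p))^2"
      unfolding power2_eq_square by (intro mult_mono) auto
    then have mm: "real (card (B z)) * real (card (C z)) \<le> 2 powr (2 * real m / 3)" using m by linarith
    have "(\<Sum>w\<in>F z. h (z, w)) \<le> (\<Sum>w\<in>incid A (B z) (C z). h (z, w))"
      by (rule sum_mono2[OF finI Fsub]) (auto simp: h_def)
    also have "\<dots> = (\<Sum>(b, c)\<in>incid A (B z) (C z). pmf PZ z * ((pmf P1 (z, b) / pmf PZ z) * (pmf P2 (z, c) / pmf PZ z)) powr (2/3))"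
    proof (rule sum.cong[OF refl], clarify)
      fix b c
      have e1: "((pmf P1 (z, b) / pmf PZ z) * (pmf P2 (z, c) / pmf PZ z)) powr (2/3)
          = (pmf P1 (z, b) * pmf P2 (z, c)) powr (2/3) / (pmf PZ z * pmf PZ z) powr (2/3)"
        by (simp add: powr_divide)
      have e2: "pmf PZ z / (pmf PZ z * pmf PZ z) powr (2/3) = 1 / pmf PZ z powr (1/3)"
      proof -
        have "(pmf PZ z * pmf PZ z) powr (2/3) = pmf PZ z powr (4/3)"
          using pz by (simp add: powr_mult flip: powr_add)
        moreover have "pmf PZ z powr (4/3) = pmf PZ z * pmf PZ z powr (1/3)"
          using pz powr_add[of "pmf PZ z" 1 "1/3"] by simp
        ultimately show ?thesis using pz by simp
      qed
      have "pmf PZ z * (((pmf P1 (z, b) / pmf PZ z) * (pmf P2 (z, c) / pmf PZ z)) powr (2/3))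
          = (pmf P1 (z, b) * pmf P2 (z, c)) powr (2/3) * (pmf PZ z / (pmf PZ z * pmf PZ z) powr (2/3))"
        unfolding e1 by (simp add: mult.commute)
      then show "h (z, b, c) = pmf PZ z * ((pmf P1 (z, b) / pmf PZ z) * (pmf P2 (z, c) / pmf PZ z)) powr (2/3)"
        unfolding e2 h_def by simp
    qed
    also have "\<dots> = pmf PZ z * (\<Sum>(b, c)\<in>incid A (B z) (C z). ((pmf P1 (z, b) / pmf PZ z) * (pmf P2 (z, c) / pmf PZ z)) powr (2/3))"
      by (simp add: sum_distrib_left case_prod_unfold)
    also have "\<dots> \<le> pmf PZ z * \<Lambda>" unfolding \<Lambda>_def
      by (intro mult_left_mono weighted_incid[OF A finBC _ _ _ _ mm])
        (use pz s1 in \<open>auto simp: B_def C_def intro!: divide_pos_pos pmf_positive\<close>)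
    finally show ?thesis .
  qed
  have "(\<Sum>s\<in>set_pmf p. t s * pmf p s) = measure_pmf.expectation p (\<lambda>s. (\<lambda>w. h w / pmf PW w) (Z s, \<beta> s, \<gamma> s))"
    by (simp add: expectation_sum[OF fin] t_def)
  also have "\<dots> = measure_pmf.expectation PW (\<lambda>w. h w / pmf PW w)" by (simp add: PW_def integral_map_pmf)
  also have "\<dots> = (\<Sum>w\<in>set_pmf PW. h w)"
    unfolding expectation_sum[OF fins(4)] by (rule sum.cong) (auto simp: set_pmf_eq)
  also have "set_pmf PW = Sigma (set_pmf PZ) F" by (auto simp: F_def PW_def PZ_def)
  also have "(\<Sum>w\<in>Sigma (set_pmf PZ) F. h w) = (\<Sum>z\<in>set_pmf PZ. \<Sum>w\<in>F z. h (z, w))"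
    using fins finF by (subst sum.Sigma) auto
  also have "\<dots> \<le> (\<Sum>z\<in>set_pmf PZ. pmf PZ z * \<Lambda>)" by (intro sum_mono fibre)
  also have "\<dots> = \<Lambda>" using sum_pmf_eq_1[OF fins(3) order_refl] by (simp flip: sum_distrib_right)
  finally have t1: "(\<Sum>s\<in>set_pmf p. t s * pmf p s) \<le> \<Lambda>" .
  have one: "(\<Sum>s\<in>set_pmf p. pmf p s) = 1" using fin by (intro sum_pmf_eq_1) auto
  let ?l = "\<lambda>s. 2/3 * ln (pmf P1 (Z s, \<beta> s)) + 2/3 * ln (pmf P2 (Z s, \<gamma> s)) - ln (pmf PW (Z s, \<beta> s, \<gamma> s)) - 1/3 * ln (pmf PZ (Z s))"
  have "ent p (\<lambda>s. (Z s, \<beta> s, \<gamma> s)) + 1/3 * ent p Z - 2/3 * ent p (\<lambda>s. (Z s, \<beta> s)) - 2/3 * ent p (\<lambda>s. (Z s, \<gamma> s))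
      = (\<Sum>s\<in>set_pmf p. ?l s * pmf p s)"
    unfolding ent_sum[OF fin] P1_def P2_def PZ_def PW_def
    by (simp add: algebra_simps sum.distrib sum_subtractf sum_negf sum_distrib_left)
  also have "\<dots> \<le> (\<Sum>s\<in>set_pmf p. (t s / \<Lambda> - 1 + ln \<Lambda>) * pmf p s)"
  proof (rule sum_mono, rule mult_right_mono)
    fix s assume s: "s \<in> set_pmf p"
    note ps = pos[OF s]
    have tp: "t s > 0" using ps by (simp add: t_def h_def)
    have "ln (t s) = ?l s" using ps
      by (simp add: t_def h_def ln_div ln_mult ln_powr algebra_simps)
    \<comment> \<open>The tangent of \<open>ln\<close> at \<Lambda>, that is, Jensen's inequality
      pointwise.\<close>
    moreover have "ln (t s / \<Lambda>) \<le> t s / \<Lambda> - 1" using tp \<Lambda> by (intro ln_le_minus_one) auto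
    moreover have "ln (t s / \<Lambda>) = ln (t s) - ln \<Lambda>" using tp \<Lambda> by (simp add: ln_div)
    ultimately show "?l s \<le> t s / \<Lambda> - 1 + ln \<Lambda>" by linarith
  qed simp
  also have "\<dots> = (\<Sum>s\<in>set_pmf p. t s * pmf p s) / \<Lambda> + (ln \<Lambda> - 1) * (\<Sum>s\<in>set_pmf p. pmf p s)"
    by (simp add: algebra_simps sum.distrib sum_subtractf sum_divide_distrib sum_distrib_left)
  also have "\<dots> \<le> ln \<Lambda>" using t1 one \<Lambda> by (simp add: field_simps)
  finally show ?thesis unfolding \<Lambda>_def by linarith
qed

section \<open>Laws on a convex set\<close>


locale convex_law =
  fixes A :: "real set"
  assumes convex: "convex_set A" and nonempty: "A \<noteq> {}"
begin

definition L :: real where "L = ln (real (card A))"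
text \<open>The logarithm of the doubling constant |A+A| / |A|.\<close>

definition \<kappa> :: real where "\<kappa> = ln (real (card (sumset A))) - L"
text \<open>192 is 3/2 times 128: the square of a support of size \<open>card A ^ 64\<close> then
  meets the requirement \<open>2 powr (2 * m / 3)\<close> of \<open>ent_control_aux\<close>. The
  exponent 64 is a common cap; the largest law constructed below has exponent 40.\<close>

definition m :: nat where "m = nat \<lceil>192 * log 2 (real (card A))\<rceil>"
definition err :: real where "err = 3 * ln (17 * (real m + 1)^2)"
text \<open>Control depends on the law only through the number of dyadic levels, so supports
  polynomial in \<open>card A\<close> keep a single \<open>err\<close> valid for all laws.\<close>

definition bnd :: "nat \<Rightarrow> 's pmf \<Rightarrow> bool" where
  "bnd n p \<longleftrightarrow> finite (set_pmf p) \<and> card (set_pmf p) \<le> card A ^ n"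

lemma finA: "finite A" using convex by (simp add: convex_set_def)
lemma N1: "1 \<le> card A" using finA nonempty by (simp add: Suc_leI card_gt_0_iff)

lemma err_nonneg: "0 \<le> err"
proof -
  have "1 \<le> (real m + 1)^2" by simp
  then have "1 \<le> 17 * (real m + 1)^2" by linarith
  then show ?thesis unfolding err_def by simp
qed

lemma finS: "finite (sumset A)"
proof -
  have "sumset A = (\<lambda>(a, b). a + b) ` (A \<times> A)" by (auto simp: sumset_def)
  then show ?thesis using finA by simp
qed

lemma bnd_fin: "bnd n p \<Longrightarrow> finite (set_pmf p)" by (simp add: bnd_def)

lemma bnd_map: "bnd n p \<Longrightarrow> bnd n (map_pmf f p)"
  by (auto simp: bnd_def intro: order_trans[OF card_image_le])

lemma bnd_glue:
  assumes "map_pmf f p = map_pmf g q" "bnd i p" "bnd j q"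
  shows "bnd (i + j) (glue p f q g)"
proof -
  have "card (set_pmf p) * card (set_pmf q) \<le> card A ^ i * card A ^ j"
    using assms by (intro mult_mono) (auto simp: bnd_def)
  then show ?thesis
    using card_glue[OF assms(1)] finite_glue[OF assms(1)] assms
    unfolding bnd_def power_add by (meson order_trans)
qed

lemma bnd_mono: "bnd i p \<Longrightarrow> i \<le> j \<Longrightarrow> bnd j p"
  unfolding bnd_def using N1 by (meson order_trans power_increasing)

lemma bnd_sub:
  assumes "set_pmf p \<subseteq> S" "finite S" "card S \<le> card A ^ n" shows "bnd n p"
  using assms card_mono[OF assms(2,1)] finite_subset[OF assms(1,2)] unfolding bnd_def by linarith

lemma ent_A: "bnd n p \<Longrightarrow> (\<And>s. s \<in> set_pmf p \<Longrightarrow> X s \<in> A) \<Longrightarrow> ent p X \<le> L"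
  unfolding L_def by (rule ent_le_card[OF bnd_fin finA])

lemma ent_S: "bnd n p \<Longrightarrow> (\<And>s. s \<in> set_pmf p \<Longrightarrow> X s \<in> sumset A) \<Longrightarrow> ent p X \<le> L + \<kappa>"
  unfolding \<kappa>_def using ent_le_card[OF bnd_fin finS, of n p X] by simp

text \<open>Monotonicity is built in: \<open>P\<close> and \<open>Q\<close> may be any variables
  that determine the two pairs, and \<open>W\<close> anything determined by the triple, so each use
  can be stated in convenient coordinates. A constant \<open>Z\<close> gives the unconditional
  form.\<close>

lemma ent_control:
  assumes b: "bnd 64 p" and mem: "\<And>s. s \<in> set_pmf p \<Longrightarrow> \<beta> s + \<gamma> s \<in> A"
    and P: "det p P (\<lambda>s. (Z s, \<beta> s))" and Q: "det p Q (\<lambda>s. (Z s, \<gamma> s))"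
    and W: "det p (\<lambda>s. (Z s, \<beta> s, \<gamma> s)) W"
  shows "3 * ent p W + ent p Z \<le> L + 2 * ent p P + 2 * ent p Q + err"
proof -
  have fin: "finite (set_pmf p)" using b by (rule bnd_fin)
  have N: "real (card A) \<ge> 1" using N1 by simp
  have "real (card (set_pmf p)) \<le> real (card A) ^ 64" using b unfolding bnd_def by (metis of_nat_le_iff of_nat_power)
  then have "real (card (set_pmf p))^2 \<le> (real (card A) ^ 64)^2" by (intro power_mono) auto
  also have "\<dots> = real (card A) powr 128" using N by (simp add: powr_numeral flip: power_mult)
  also have "\<dots> = 2 powr (128 * log 2 (real (card A)))" using N by (simp add: powr_def log_def)
  also have "\<dots> \<le> 2 powr (2 * real m / 3)"
  proof (rule powr_mono)
    have "192 * log 2 (real (card A)) \<le> real m" unfolding m_def by linarith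
    then show "128 * log 2 (real (card A)) \<le> 2 * real m / 3" by simp
  qed simp
  finally have c2: "real (card (set_pmf p))^2 \<le> 2 powr (2 * real m / 3)" .
  have "1 + 16 * (real m + 1)^2 * real (card A) powr (1/3) \<le> 17 * (real m + 1)^2 * real (card A) powr (1/3)"
  proof -
    have "1 \<le> real (card A) powr (1/3)" using N by (simp add: ge_one_powr_ge_zero)
    then have "1 * 1 \<le> (real m + 1)^2 * real (card A) powr (1/3)" by (intro mult_mono) auto
    then show ?thesis by simp
  qed
  then have "3 * ln (1 + 16 * (real m + 1)^2 * real (card A) powr (1/3)) \<le> 3 * ln (17 * (real m + 1)^2 * real (card A) powr (1/3))"
    using N by (intro mult_left_mono) (auto intro!: ln_mono add_pos_nonneg)
  also have "\<dots> = L + err" using N by (simp add: err_def L_def ln_mult ln_powr)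
  finally have l: "3 * ln (1 + 16 * (real m + 1)^2 * real (card A) powr (1/3)) \<le> L + err" .
  have "3 * ent p (\<lambda>s. (Z s, \<beta> s, \<gamma> s)) + ent p Z \<le> 2 * ent p (\<lambda>s. (Z s, \<beta> s)) + 2 * ent p (\<lambda>s. (Z s, \<gamma> s))
     + 3 * ln (1 + 16 * (real m + 1)^2 * real (card A) powr (1/3))"
    by (rule ent_control_aux[OF convex fin _ c2]) (rule mem)
  then show ?thesis using l ent_mono[OF fin P] ent_mono[OF fin Q] ent_mono[OF fin W] by argo
qed

section \<open>Parallel translates and pairs of sums with a prescribed difference\<close>

text \<open>Two copies glued over the sums \<open>(a + b, a + c)\<close> differ by a translation
  \<open>(-d, d, d)\<close>. The pairs \<open>(a, a1)\<close>, \<open>(b, b1)\<close>,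
  \<open>(c, c1)\<close> each determine \<open>d\<close> and jointly determine everything, so two
  submodularities gain \<open>2 * H(d)\<close>. Control costs \<open>2/3 * H(d)\<close> for each of
  the three pairs, so \<open>d\<close> cancels exactly.\<close>

lemma prism:
  fixes p :: "(real \<times> real \<times> real) pmf"
  assumes A: "set_pmf p \<subseteq> A \<times> A \<times> A"
  shows "6 * ent p (\<lambda>s. s) \<le> 3 * ent p (\<lambda>(a, b, c). (a + b, a + c)) + 3 * L
    + 2 * (ent p (\<lambda>(a, b, c). a) + ent p (\<lambda>(a, b, c). b) + ent p (\<lambda>(a, b, c). c)) + 3 * err"
proof -
  have b3: "bnd 3 p"
    by (rule bnd_sub[OF A]) (auto simp: finA card_cartesian_product power3_eq_cube)
  note fp = bnd_fin[OF b3]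
  define f where "f = (\<lambda>(a::real, b, c). (a + b, a + c))"
  define r where "r = glue p f p f"
  have br: "bnd 64 r" unfolding r_def by (rule bnd_mono[OF bnd_glue[OF refl b3 b3]]) simp
  note fr = bnd_fin[OF br]
  have supp: "a \<in> A \<and> b \<in> A \<and> c \<in> A \<and> a1 \<in> A \<and> b1 \<in> A \<and> c1 \<in> A \<and> a1 = a + b - b1 \<and> c1 = c + b1 - b"
    if "((a, b, c), (a1, b1, c1)) \<in> set_pmf r" for a b c a1 b1 c1
    using that A unfolding r_def set_glue[OF refl fp fp] f_def by auto
  define d where "d = (\<lambda>((a::real, b::real, c::real), (a1::real, b1::real, c1::real)). b1 - b)"
  have tot: "ent r (\<lambda>s. s) = 2 * ent p (\<lambda>s. s) - ent p f"
    unfolding r_def by (simp add: ent_glue[OF refl fp fp])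
  have marg: "ent r (\<lambda>s. F (snd s)) = ent p F" for F :: "_ \<Rightarrow> real"
    using ent_map[of snd r F] snd_glue[OF refl fp fp, of f] unfolding r_def by simp
  let ?aa = "\<lambda>((a, b, c), (a1, b1, c1)). (a, a1)" and ?bb = "\<lambda>((a, b, c), (a1, b1, c1)). (b, b1)"
    and ?cc = "\<lambda>((a, b, c), (a1, b1, c1)). (c, c1)" and ?ab = "\<lambda>((a, b, c), (a1, b1, c1)). (a, b, a1, b1)"
  have s1: "ent r ?ab + ent r d \<le> ent r ?aa + ent r ?bb"
    by (rule ent_submod[OF fr]) (auto simp: det_def d_def dest!: supp)
  have s2: "ent r (\<lambda>s. s) + ent r d \<le> ent r ?ab + ent r ?cc"
    by (rule ent_submod[OF fr]) (auto simp: det_def d_def dest!: supp)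
  have c1: "3 * ent r ?aa + ent r (\<lambda>_. ()) \<le> L + 2 * ent r (\<lambda>s. (\<lambda>(a, b, c). a) (snd s)) + 2 * ent r d + err"
    by (rule ent_control[OF br, where \<beta> = "\<lambda>s. fst (snd s)" and \<gamma> = d]) (auto simp: det_def d_def dest!: supp)
  have c2: "3 * ent r ?bb + ent r (\<lambda>_. ()) \<le> L + 2 * ent r (\<lambda>s. (\<lambda>(a, b, c). b) (snd s)) + 2 * ent r d + err"
    by (rule ent_control[OF br, where \<beta> = "\<lambda>s. fst (snd (snd s))" and \<gamma> = "\<lambda>s. - d s"]) (auto simp: det_def d_def dest!: supp)
  have c3: "3 * ent r ?cc + ent r (\<lambda>_. ()) \<le> L + 2 * ent r (\<lambda>s. (\<lambda>(a, b, c). c) (snd s)) + 2 * ent r d + err"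
    by (rule ent_control[OF br, where \<beta> = "\<lambda>s. snd (snd (snd s))" and \<gamma> = "\<lambda>s. - d s"]) (auto simp: det_def d_def dest!: supp)
  note c = c1[unfolded marg ent_const] c2[unfolded marg ent_const] c3[unfolded marg ent_const]
  have "6 * ent p (\<lambda>s. s) \<le> 3 * ent p f + 3 * L
    + 2 * (ent p (\<lambda>(a, b, c). a) + ent p (\<lambda>(a, b, c). b) + ent p (\<lambda>(a, b, c). c)) + 3 * err"
    using s1 s2 c tot by argo
  then show ?thesis unfolding f_def .
qed

text \<open>In the coordinates \<open>(a, b, x)\<close> the two sums are \<open>a + b\<close>, with
  a chosen representation, and \<open>a + b - x\<close>. Prescribing the law of \<open>x\<close> as
  that of the differences of \<pi> allows gluing along \<open>x\<close>; the last clause says that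
  such pairs of sums are plentiful.\<close>

definition rs_for :: "(real \<times> real) pmf \<Rightarrow> (real \<times> real \<times> real) pmf \<Rightarrow> bool" where
  "rs_for \<pi> \<rho> \<longleftrightarrow> bnd 6 \<rho>
    \<and> (\<forall>a b x. (a, b, x) \<in> set_pmf \<rho> \<longrightarrow> a \<in> A \<and> b \<in> A \<and> a + b - x \<in> sumset A)
    \<and> map_pmf (\<lambda>(a, b, x). x) \<rho> = map_pmf (\<lambda>(b, c). b - c) \<pi>
    \<and> ent \<rho> (\<lambda>(a, b, x). b) = ent \<pi> fst
    \<and> 3 * L + 6 * ent \<pi> (\<lambda>s. s) - 2 * (L + ent \<pi> fst + ent \<pi> snd) - 3 * err + 3 * ent \<pi> fst - 3 * \<kappa> \<le> 3 * ent \<rho> (\<lambda>s. s)"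

text \<open>Adding an independent uniform element of \<open>A\<close> to both entries of a pair from
  \<pi> gives two sums with the same difference, and \<open>prism\<close> bounds the entropy lost on
  passing to the sums. Gluing a fresh representation of the first sum then gains at least
  \<open>ent \<pi> fst - \<kappa>\<close>.\<close>

lemma rs_law:
  fixes \<pi> :: "(real \<times> real) pmf"
  assumes A: "set_pmf \<pi> \<subseteq> A \<times> A"
  shows "\<exists>\<rho>. rs_for \<pi> \<rho>"
proof -
  define u where "u = pmf_of_set A"
  have su: "set_pmf u = A" using finA nonempty by (simp add: u_def)
  have bu: "bnd 1 u" by (rule bnd_sub[of _ A]) (auto simp: su finA)
  have b\<pi>: "bnd 2 \<pi>" by (rule bnd_sub[OF A]) (auto simp: finA card_cartesian_product power2_eq_square)
  have eq0: "map_pmf (\<lambda>_. ()) u = map_pmf (\<lambda>_. ()) \<pi>" by simp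
  define g0 where "g0 = glue u (\<lambda>_. ()) \<pi> (\<lambda>_. ())"
  have bg: "bnd 3 g0" unfolding g0_def by (rule bnd_mono[OF bnd_glue[OF eq0 bu b\<pi>]]) simp
  have sg: "set_pmf g0 = A \<times> set_pmf \<pi>" unfolding g0_def set_glue[OF eq0 bnd_fin[OF bu] bnd_fin[OF b\<pi>]] su by auto
  have eg: "ent g0 (\<lambda>s. s) = L + ent \<pi> (\<lambda>s. s)"
    unfolding g0_def ent_glue[OF eq0 bnd_fin[OF bu] bnd_fin[OF b\<pi>]] using ent_uniform[OF finA nonempty] by (simp add: u_def L_def)
  have mf: "map_pmf fst g0 = u" "map_pmf snd g0 = \<pi>"
    unfolding g0_def by (rule fst_glue[OF eq0 bnd_fin[OF bu] bnd_fin[OF b\<pi>]], rule snd_glue[OF eq0 bnd_fin[OF bu] bnd_fin[OF b\<pi>]])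
  note fg = bnd_fin[OF bg]
  have Ag: "set_pmf g0 \<subseteq> A \<times> A \<times> A" using sg A by auto
  have mem: "a \<in> A \<and> b \<in> A \<and> c \<in> A" if "(a, b, c) \<in> set_pmf g0" for a b c using that Ag by auto
  have m\<pi>: "ent g0 (\<lambda>s. F (snd s)) = ent \<pi> F" for F :: "_ \<Rightarrow> 'f"
    using ent_map[of snd g0 F] by (simp add: mf)
  have mb: "ent g0 (\<lambda>(a, b, c). b) = ent \<pi> fst" "ent g0 (\<lambda>(a, b, c). c) = ent \<pi> snd" "ent g0 (\<lambda>(a, b, c). (b, c)) = ent \<pi> (\<lambda>s. s)"
    using m\<pi>[of fst] m\<pi>[of snd] m\<pi>[of "\<lambda>s. s"] by (simp_all add: case_prod_unfold)
  have ma: "ent g0 (\<lambda>(a, b, c). a) \<le> L" by (rule ent_A[OF bg]) (auto dest: mem)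
  have \<tau>: "6 * ent g0 (\<lambda>s. s) \<le> 3 * ent g0 (\<lambda>(a, b, c). (a + b, a + c)) + 3 * L
    + 2 * (ent g0 (\<lambda>(a, b, c). a) + ent g0 (\<lambda>(a, b, c). b) + ent g0 (\<lambda>(a, b, c). c)) + 3 * err"
    by (rule prism[OF Ag])
  \<comment> \<open>Since the added element is independent of the pair, this bounds the entropy of
    \<open>(a, b)\<close> below by \<open>L + ent \<pi> fst\<close>.\<close>
  have ab: "ent g0 (\<lambda>s. s) + ent g0 (\<lambda>(a, b, c). b) \<le> ent g0 (\<lambda>(a, b, c). (a, b)) + ent g0 (\<lambda>(a, b, c). (b, c))"
    by (rule ent_submod[OF fg]) (auto simp: det_def)
  have hp: "ent g0 (\<lambda>(a, b, c). a + b) \<le> L + \<kappa>"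
    by (rule ent_S[OF bg]) (auto dest!: mem simp: sumset_def)
  define pq where "pq = map_pmf (\<lambda>(a, b, c). (a + b, a + c)) g0"
  define l where "l = map_pmf (\<lambda>(a, b, c). (a, b)) g0"
  have bpq: "bnd 3 pq" "bnd 3 l" unfolding pq_def l_def by (rule bnd_map[OF bg])+
  have eq1: "map_pmf fst pq = map_pmf (\<lambda>(a, b). a + b) l"
    by (simp add: pq_def l_def map_pmf_comp case_prod_unfold)
  note glu = eq1 bnd_fin[OF bpq(1)] bnd_fin[OF bpq(2)]
  define r where "r = glue pq fst l (\<lambda>(a, b). a + b)"
  have br: "bnd 6 r" using bnd_glue[OF eq1 bpq] by (simp add: r_def)
  define F :: "(real \<times> real) \<times> real \<times> real \<Rightarrow> real \<times> real \<times> real" where "F = (\<lambda>((p, q), (a, b)). (a, b, p - q))"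
  define \<rho> where "\<rho> = map_pmf F r"
  have sr: "a \<in> A \<and> b \<in> A \<and> p = a + b \<and> q \<in> sumset A" if "((p, q), (a, b)) \<in> set_pmf r" for p q a b
    using that Ag unfolding r_def set_glue[OF glu] by (fastforce simp: pq_def l_def sumset_def)
  show ?thesis unfolding rs_for_def
  proof (intro exI[of _ \<rho>] conjI allI impI)
    show "bnd 6 \<rho>" unfolding \<rho>_def by (rule bnd_map[OF br])
    show "a \<in> A" "b \<in> A" "a + b - x \<in> sumset A" if "(a, b, x) \<in> set_pmf \<rho>" for a b x
      using that by (auto simp: \<rho>_def F_def dest!: sr)
    have "map_pmf (\<lambda>(a, b, x). x) \<rho> = map_pmf (\<lambda>(p, q). p - q) (map_pmf fst r)"
      by (simp add: \<rho>_def F_def map_pmf_comp case_prod_unfold)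
    also have "map_pmf fst r = pq" unfolding r_def by (rule fst_glue[OF glu])
    also have "map_pmf (\<lambda>(p, q). p - q) pq = map_pmf (\<lambda>(b, c). b - c) (map_pmf snd g0)"
      by (simp add: pq_def map_pmf_comp case_prod_unfold)
    finally show "map_pmf (\<lambda>(a, b, x). x) \<rho> = map_pmf (\<lambda>(b, c). b - c) \<pi>" by (simp add: mf)
    have "ent \<rho> (\<lambda>(a, b, x). b) = ent (map_pmf snd r) snd"
      by (simp add: \<rho>_def F_def ent_map case_prod_unfold)
    also have "map_pmf snd r = l" unfolding r_def by (rule snd_glue[OF glu])
    also have "ent l snd = ent \<pi> fst" using mb(1) by (simp add: l_def ent_map case_prod_unfold)
    finally show "ent \<rho> (\<lambda>(a, b, x). b) = ent \<pi> fst" .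
    have "ent \<rho> (\<lambda>s. s) = ent r F" by (simp add: \<rho>_def ent_map)
    also have "\<dots> = ent r (\<lambda>s. s)"
      by (rule ent_cong[OF bnd_fin[OF br]]) (auto simp: det_def F_def dest!: sr)
    also have "\<dots> = ent pq (\<lambda>s. s) + ent l (\<lambda>s. s) - ent pq fst" unfolding r_def by (rule ent_glue[OF glu])
    also have "\<dots> = ent g0 (\<lambda>(a, b, c). (a + b, a + c)) + ent g0 (\<lambda>(a, b, c). (a, b)) - ent g0 (\<lambda>(a, b, c). a + b)"
      by (simp add: pq_def l_def ent_map case_prod_unfold)
    finally show "3 * L + 6 * ent \<pi> (\<lambda>s. s) - 2 * (L + ent \<pi> fst + ent \<pi> snd) - 3 * err + 3 * ent \<pi> fst - 3 * \<kappa> \<le> 3 * ent \<rho> (\<lambda>s. s)"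
      using \<tau> ab hp ma unfolding eg mb by argo
  qed
qed

text \<open>Pairs of high entropy force differences of high entropy. The law from
  \<open>rs_law\<close> is bounded above through \<open>y = b - x\<close>: both
  \<open>(a + b - x) - y = a\<close> and \<open>x + y = b\<close> lie in \<open>A\<close>, so
  control applies twice, and with the second estimate halved the entropy of \<open>y\<close>
  cancels.\<close>

lemma pair_cap:
  fixes \<pi> :: "(real \<times> real) pmf"
  assumes A: "set_pmf \<pi> \<subseteq> A \<times> A"
  shows "12 * ent \<pi> (\<lambda>s. s) - 5 * ent \<pi> (\<lambda>(b, c). b - c) \<le> 10 * L + 10 * \<kappa> + 12 * err"
proof -
  obtain \<rho> where r: "rs_for \<pi> \<rho>" using rs_law[OF A] by blast
  have \<rho>: "bnd 6 \<rho>"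
    "\<And>a b x. (a, b, x) \<in> set_pmf \<rho> \<Longrightarrow> a \<in> A \<and> b \<in> A \<and> a + b - x \<in> sumset A"
    "map_pmf (\<lambda>(a, b, x). x) \<rho> = map_pmf (\<lambda>(b, c). b - c) \<pi>"
    "ent \<rho> (\<lambda>(a, b, x). b) = ent \<pi> fst"
    "3 * L + 6 * ent \<pi> (\<lambda>s. s) - 2 * (L + ent \<pi> fst + ent \<pi> snd) - 3 * err + 3 * ent \<pi> fst - 3 * \<kappa> \<le> 3 * ent \<rho> (\<lambda>s. s)"
    using r[unfolded rs_for_def] by simp_all
  have b\<pi>: "bnd 2 \<pi>" by (rule bnd_sub[OF A]) (auto simp: finA card_cartesian_product power2_eq_square)
  have q1: "ent \<pi> fst \<le> L" "ent \<pi> snd \<le> L" using A by (auto intro!: ent_A[OF b\<pi>])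
  have b64: "bnd 64 \<rho>" by (rule bnd_mono[OF \<rho>(1)]) simp
  note fr = bnd_fin[OF \<rho>(1)]
  have x: "ent \<rho> (\<lambda>(a, b, x). x) = ent \<pi> (\<lambda>(b, c). b - c)"
    using ent_map[of "\<lambda>(a, b, x). x" \<rho> "\<lambda>x. x"] ent_map[of "\<lambda>(b, c). b - c" \<pi> "\<lambda>x. x"] \<rho>(3)
    by (simp add: case_prod_unfold)
  have s1: "ent \<rho> (\<lambda>s. s) + ent \<rho> (\<lambda>(a, b, x). b - x) \<le> ent \<rho> (\<lambda>(a, b, x). (a, b - x)) + ent \<rho> (\<lambda>(a, b, x). (b, x))"
    by (rule ent_submod[OF fr]) (auto simp: det_def)
  have s2: "ent \<rho> (\<lambda>(a, b, x). (b, x)) + ent \<rho> (\<lambda>_. ()) \<le> ent \<rho> (\<lambda>(a, b, x). b) + ent \<rho> (\<lambda>(a, b, x). x)"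
    by (rule ent_submod[OF fr]) (auto simp: det_def)
  have c1: "3 * ent \<rho> (\<lambda>(a, b, x). (a, b - x)) + ent \<rho> (\<lambda>_. ()) \<le> L + 2 * ent \<rho> (\<lambda>(a, b, x). a + b - x) + 2 * ent \<rho> (\<lambda>(a, b, x). b - x) + err"
    by (rule ent_control[OF b64, where \<beta> = "\<lambda>(a, b, x). a + b - x" and \<gamma> = "\<lambda>(a, b, x). - (b - x)"])
      (auto simp: det_def dest!: \<rho>(2))
  have c2: "3 * ent \<rho> (\<lambda>(a, b, x). (b, x)) + ent \<rho> (\<lambda>_. ()) \<le> L + 2 * ent \<rho> (\<lambda>(a, b, x). x) + 2 * ent \<rho> (\<lambda>(a, b, x). b - x) + err"
    by (rule ent_control[OF b64, where \<beta> = "\<lambda>(a, b, x). x" and \<gamma> = "\<lambda>(a, b, x). b - x"])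
      (auto simp: det_def dest!: \<rho>(2))
  have hq: "ent \<rho> (\<lambda>(a, b, x). a + b - x) \<le> L + \<kappa>"
    by (rule ent_S[OF \<rho>(1)]) (auto dest!: \<rho>(2))
  show ?thesis using s1 s2 c1 c2 hq q1 \<rho>(4,5) err_nonneg unfolding x ent_const by argo
qed
end

section \<open>The linear programming certificate\<close>

text \<open>A Farkas certificate: all entropies are treated as free reals, and the weights make
  everything cancel except \<open>L\<close>, \<open>k\<close> and \<open>e\<close>. Scaling each
  premise and adding leaves only a ring normalisation. The exponent depends on 3096/5280 alone;
  60000 is a generous round coefficient for the error. Premises named r, t, v, y (with a number)
  belong to the laws \<open>R\<close>, \<open>T\<close>, \<open>V\<close>, \<open>Y\<close> of
  \<open>entropy_bound\<close>.\<close>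

lemma entropy_certificate:
  fixes H_F H_R1 H_T H_a2y H_b2bc H_b2bcv H_b2c H_b2cc H_b2cd H_b2x H_ba2y H_bby H_bce H_beyv H_bez H_bv H_bvw H_by H_byv H_bz H_cd H_ey H_eyv H_ez H_u H_vb H_wvb H_y H_yv H_z L R2 VV YY e k q1 q2 q3 qx rho :: real
  assumes energy: "3*L - k \<le> q3"
    and q3b: "q3 \<le> 2*q2 - qx"
    and q1: "q1 \<le> L"
    and RS: "3*L + 6*q2 - 2*(L + q1 + q1) - 3*e + 3*q1 - 3*k \<le> 3*rho"
    and r1: "H_ba2y + H_y \<le> H_by + H_a2y"
    and r2: "H_F + H_by \<le> H_b2bc + H_ba2y"
    and r3q: "H_b2bc + qx \<le> H_b2x + q2"
    and r3p: "rho + q2 - qx \<le> H_F"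
    and r4: "H_R1 + H_T \<le> H_b2cc + H_bby"
    and r4p: "H_b2x + q3 - qx \<le> H_R1"
    and r5: "H_b2cc + q1 \<le> H_b2c + q2"
    and r6: "H_u \<le> L + k"
    and r7: "3*H_by \<le> L + 2*H_u + 2*H_y + e"
    and r7e: "3*H_ey \<le> L + 2*(L + k) + 2*H_y + e"
    and r8: "H_b2bc + q1 \<le> H_b2c + q2"
    and r9: "3*H_b2bc + q1 \<le> L + 2*H_b2c + 2*H_b2x + e"
    and r10: "3*H_a2y \<le> L + 2*(L + k) + 2*H_y + e"
    and P1: "6*H_b2cc \<le> 3*H_T + 3*L + 2*(q1 + q1 + q1) + 3*e"
    and R2CI: "R2 = H_b2bc + H_bby - H_by"
    and t1: "R2 + H_cd \<le> H_b2cd + H_bce"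
    and t2: "3*H_bce + q1 \<le> L + 2*q2 + 2*H_cd + e"
    and VCI: "VV = R2 + H_b2cd - H_T"
    and v1: "H_byv + H_z \<le> H_bz + H_yv"
    and v2: "H_b2bcv + H_by \<le> H_b2bc + H_byv"
    and v34: "VV + H_by \<le> H_b2bc + H_beyv"
    and v5: "H_beyv + H_ez \<le> H_bez + H_eyv"
    and v67: "VV + H_by \<le> H_b2bcv + H_bby"
    and v8: "VV + H_yv \<le> H_b2bcv + H_eyv"
    and v9: "3*H_eyv + q1 \<le> L + 2*H_ey + 2*H_ez + e"
    and v10: "3*H_bez + q1 \<le> L + 2*H_bz + 2*H_cd + e"
    and v11: "3*H_yv \<le> L + 2*H_y + 2*H_z + e"
    and v12: "H_bez + qx \<le> q2 + H_cd"
    and v13: "12*H_bz - 5*H_z \<le> 10*L + 10*k + 12*e"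
    and YCI: "YY = H_bby + H_b2c - H_u"
    and y1: "YY + H_by \<le> H_bby + H_bvw"
    and y2: "H_bvw + H_vb \<le> H_bv + H_wvb"
    and y3: "3*H_wvb \<le> L + 2*H_vb + 2*H_y + e"
    and y4: "H_bv \<le> q1 + q1"
    and y5: "12*H_bv - 5*H_vb \<le> 10*L + 10*k + 12*e"
    and e0: "0 \<le> e"
  shows "3096 * L \<le> 5280 * k + 60000 * e"
proof -
  have s_energy: "2145 * (3*L - k) \<le> 2145 * (q3)" by (rule mult_left_mono[OF energy]) simp
  have s_q3b: "1380 * (q3) \<le> 1380 * (2*q2 - qx)" by (rule mult_left_mono[OF q3b]) simp
  have s_q1: "629 * (q1) \<le> 629 * (L)" by (rule mult_left_mono[OF q1]) simp
  have s_RS: "440 * (3*L + 6*q2 - 2*(L + q1 + q1) - 3*e + 3*q1 - 3*k) \<le> 440 * (3*rho)" by (rule mult_left_mono[OF RS]) simp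
  have s_r1: "1320 * (H_ba2y + H_y) \<le> 1320 * (H_by + H_a2y)" by (rule mult_left_mono[OF r1]) simp
  have s_r2: "1320 * (H_F + H_by) \<le> 1320 * (H_b2bc + H_ba2y)" by (rule mult_left_mono[OF r2]) simp
  have s_r3q: "675 * (H_b2bc + qx) \<le> 675 * (H_b2x + q2)" by (rule mult_left_mono[OF r3q]) simp
  have s_r3p: "1320 * (rho + q2 - qx) \<le> 1320 * (H_F)" by (rule mult_left_mono[OF r3p]) simp
  have s_r4: "765 * (H_R1 + H_T) \<le> 765 * (H_b2cc + H_bby)" by (rule mult_left_mono[OF r4]) simp
  have s_r4p: "765 * (H_b2x + q3 - qx) \<le> 765 * (H_R1)" by (rule mult_left_mono[OF r4p]) simp
  have s_r5: "135 * (H_b2cc + q1) \<le> 135 * (H_b2c + q2)" by (rule mult_left_mono[OF r5]) simp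
  have s_r6: "305 * (H_u) \<le> 305 * (L + k)" by (rule mult_left_mono[OF r6]) simp
  have s_r7: "10 * (3*H_by) \<le> 10 * (L + 2*H_u + 2*H_y + e)" by (rule mult_left_mono[OF r7]) simp
  have s_r7e: "70 * (3*H_ey) \<le> 70 * (L + 2*(L + k) + 2*H_y + e)" by (rule mult_left_mono[OF r7e]) simp
  have s_r8: "60 * (H_b2bc + q1) \<le> 60 * (H_b2c + q2)" by (rule mult_left_mono[OF r8]) simp
  have s_r9: "45 * (3*H_b2bc + q1) \<le> 45 * (L + 2*H_b2c + 2*H_b2x + e)" by (rule mult_left_mono[OF r9]) simp
  have s_r10: "440 * (3*H_a2y) \<le> 440 * (L + 2*(L + k) + 2*H_y + e)" by (rule mult_left_mono[OF r10]) simp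
  have s_P1: "105 * (6*H_b2cc) \<le> 105 * (3*H_T + 3*L + 2*(q1 + q1 + q1) + 3*e)" by (rule mult_left_mono[OF P1]) simp
  have s_t1: "450 * (R2 + H_cd) \<le> 450 * (H_b2cd + H_bce)" by (rule mult_left_mono[OF t1]) simp
  have s_t2: "150 * (3*H_bce + q1) \<le> 150 * (L + 2*q2 + 2*H_cd + e)" by (rule mult_left_mono[OF t2]) simp
  have s_v1: "240 * (H_byv + H_z) \<le> 240 * (H_bz + H_yv)" by (rule mult_left_mono[OF v1]) simp
  have s_v2: "240 * (H_b2bcv + H_by) \<le> 240 * (H_b2bc + H_byv)" by (rule mult_left_mono[OF v2]) simp
  have s_v34: "210 * (VV + H_by) \<le> 210 * (H_b2bc + H_beyv)" by (rule mult_left_mono[OF v34]) simp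
  have s_v5: "210 * (H_beyv + H_ez) \<le> 210 * (H_bez + H_eyv)" by (rule mult_left_mono[OF v5]) simp
  have s_v67: "135 * (VV + H_by) \<le> 135 * (H_b2bcv + H_bby)" by (rule mult_left_mono[OF v67]) simp
  have s_v8: "105 * (VV + H_yv) \<le> 105 * (H_b2bcv + H_eyv)" by (rule mult_left_mono[OF v8]) simp
  have s_v9: "105 * (3*H_eyv + q1) \<le> 105 * (L + 2*H_ey + 2*H_ez + e)" by (rule mult_left_mono[OF v9]) simp
  have s_v10: "60 * (3*H_bez + q1) \<le> 60 * (L + 2*H_bz + 2*H_cd + e)" by (rule mult_left_mono[OF v10]) simp
  have s_v11: "45 * (3*H_yv) \<le> 45 * (L + 2*H_y + 2*H_z + e)" by (rule mult_left_mono[OF v11]) simp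
  have s_v12: "30 * (H_bez + qx) \<le> 30 * (q2 + H_cd)" by (rule mult_left_mono[OF v12]) simp
  have s_v13: "30 * (12*H_bz - 5*H_z) \<le> 30 * (10*L + 10*k + 12*e)" by (rule mult_left_mono[OF v13]) simp
  have s_y1: "285 * (YY + H_by) \<le> 285 * (H_bby + H_bvw)" by (rule mult_left_mono[OF y1]) simp
  have s_y2: "285 * (H_bvw + H_vb) \<le> 285 * (H_bv + H_wvb)" by (rule mult_left_mono[OF y2]) simp
  have s_y3: "95 * (3*H_wvb) \<le> 95 * (L + 2*H_vb + 2*H_y + e)" by (rule mult_left_mono[OF y3]) simp
  have s_y4: "57 * (H_bv) \<le> 57 * (q1 + q1)" by (rule mult_left_mono[OF y4]) simp
  have s_y5: "19 * (12*H_bv - 5*H_vb) \<le> 19 * (10*L + 10*k + 12*e)" by (rule mult_left_mono[OF y5]) simp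
  have s_e0: "30 * (0) \<le> 30 * (e)" by (rule mult_left_mono[OF e0]) simp
  show ?thesis using add_mono[OF add_mono[OF add_mono[OF add_mono[OF add_mono[OF add_mono[OF add_mono[OF add_mono[OF add_mono[OF add_mono[OF add_mono[OF add_mono[OF add_mono[OF add_mono[OF add_mono[OF add_mono[OF add_mono[OF add_mono[OF add_mono[OF add_mono[OF add_mono[OF add_mono[OF add_mono[OF add_mono[OF add_mono[OF add_mono[OF add_mono[OF add_mono[OF add_mono[OF add_mono[OF add_mono[OF add_mono[OF add_mono[OF add_mono[OF add_mono[OF add_mono[OF s_energy s_q3b] s_q1] s_RS] s_r1] s_r2] s_r3q] s_r3p] s_r4] s_r4p] s_r5] s_r6] s_r7] s_r7e] s_r8] s_r9] s_r10] s_P1] s_t1] s_t2] s_v1] s_v2] s_v34] s_v5] s_v67] s_v8] s_v9] s_v10] s_v11] s_v12] s_v13] s_y1] s_y2] s_y3] s_y4] s_y5] s_e0]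
    unfolding R2CI VCI YCI using e0 by (simp add: algebra_simps)
qed

section \<open>The uniform law on additive quadruples and the laws glued to it\<close>

context convex_law begin

definition Quads :: "(real \<times> real \<times> real \<times> real) set" where
  "Quads = {(b, c, d, e). b \<in> A \<and> c \<in> A \<and> d \<in> A \<and> e \<in> A \<and> b - c = d - e}"

definition quad :: "(real \<times> real \<times> real \<times> real) pmf" where "quad = pmf_of_set Quads"

lemma Quads_sub: "Quads \<subseteq> A \<times> A \<times> A \<times> A" by (auto simp: Quads_def)

lemma finQ: "finite Quads" by (rule finite_subset[OF Quads_sub]) (simp add: finA)

lemma Quads_ne: "Quads \<noteq> {}"
proof -
  obtain a where "a \<in> A" using nonempty by blast
  then have "(a, a, a, a) \<in> Quads" by (simp add: Quads_def)
  then show ?thesis by blast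
qed

lemma set_quad: "set_pmf quad = Quads" using finQ Quads_ne by (simp add: quad_def)

lemma bnd_quad: "bnd 4 quad"
proof (rule bnd_sub)
  show "set_pmf quad \<subseteq> A \<times> A \<times> A \<times> A" unfolding set_quad by (rule Quads_sub)
  show "finite (A \<times> A \<times> A \<times> A)" by (simp add: finA)
  show "card (A \<times> A \<times> A \<times> A) \<le> card A ^ 4" by (simp add: card_cartesian_product power4_eq_xxxx)
qed

lemma quad_sym:
  assumes "\<And>s. s \<in> Quads \<Longrightarrow> f s \<in> Quads" "\<And>s. f (f s) = s"
  shows "ent quad (\<lambda>s. F (f s)) = ent quad F"
proof -
  have "bij_betw f Quads Quads" by (rule bij_betwI[of f _ _ f]) (use assms in auto)
  then have "map_pmf f quad = quad" unfolding quad_def by (rule map_pmf_of_set_bij_betw[OF _ Quads_ne finQ])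
  then show ?thesis using ent_map[of f quad F] by simp
qed

text \<open>The Cauchy-Schwarz bound |A|^4 / |A+A| for additive energy: two uniform pairs glued over
  their sum have entropy \<open>4 * L\<close> minus that of the sum, and no law on
  \<open>Quads\<close> has more entropy than the uniform one.\<close>

lemma quad_energy: "3 * L - \<kappa> \<le> ent quad (\<lambda>s. s)"
proof -
  define u where "u = pmf_of_set (A \<times> A)"
  have fu: "finite (A \<times> A)" "A \<times> A \<noteq> {}" using finA nonempty by auto
  have su: "set_pmf u = A \<times> A" unfolding u_def using fu by (intro set_pmf_of_set) auto
  have fin: "finite (set_pmf u)" by (simp add: su finA)
  have bu: "bnd 2 u" by (rule bnd_sub[of _ "A \<times> A"]) (auto simp: su finA card_cartesian_product power2_eq_square)
  define r where "r = glue u (\<lambda>(a, b). a + b) u (\<lambda>(a, b). a + b)"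
  have eu: "ent u (\<lambda>s. s) = 2 * L" unfolding u_def using ent_uniform[OF fu] N1
    by (simp add: L_def card_cartesian_product ln_mult)
  have es: "ent u (\<lambda>(a, b). a + b) \<le> L + \<kappa>"
    by (rule ent_S[OF bu]) (auto simp: su sumset_def)
  have er: "ent r (\<lambda>s. s) = 2 * L + 2 * L - ent u (\<lambda>(a, b). a + b)"
    unfolding r_def ent_glue[OF refl fin fin] eu ..
  have fr: "finite (set_pmf r)" unfolding r_def by (rule finite_glue[OF refl fin fin])
  \<comment> \<open>The relation \<open>a + b = c + d\<close> is rearranged to
    \<open>a - c = d - b\<close>.\<close>
  let ?X = "\<lambda>((a, b), (c, d)). (a, c, d, b)"
  have sr: "a \<in> A \<and> b \<in> A \<and> c \<in> A \<and> d \<in> A \<and> a + b = c + d" if "((a, b), (c, d)) \<in> set_pmf r" for a b c d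
    using that unfolding r_def set_glue[OF refl fin fin] su by auto
  have "ent r (\<lambda>s. s) \<le> ent r ?X" by (rule ent_mono[OF fr]) (auto simp: det_def)
  also have "\<dots> \<le> ln (real (card Quads))"
    by (rule ent_le_card[OF fr finQ]) (auto simp: Quads_def dest!: sr)
  finally have "ent r (\<lambda>s. s) \<le> ent quad (\<lambda>s. s)" unfolding quad_def ent_uniform[OF finQ Quads_ne] .
  then show ?thesis using er es by argo
qed

lemma entropy_bound: "3096 * L \<le> 5280 * \<kappa> + 60000 * err"
proof -
  let ?bc = "\<lambda>(b, c, d, e). (b, c)"
  define \<pi> where "\<pi> = map_pmf (\<lambda>(b, c, d, e). (b, c)) quad"
  have \<pi>A: "set_pmf \<pi> \<subseteq> A \<times> A" using Quads_sub by (auto simp: \<pi>_def set_quad)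
  note fq = bnd_fin[OF bnd_quad]
  define q1 q2 qx q3 where "q1 = ent quad (\<lambda>(b, c, d, e). b)" and "q2 = ent quad (\<lambda>(b, c, d, e). (b, c))"
    and "qx = ent quad (\<lambda>(b, c, d, e). b - c)" and "q3 = ent quad (\<lambda>s. s)"
  have qs: "b \<in> A \<and> c \<in> A \<and> d \<in> A \<and> e \<in> A \<and> e = d - b + c" if "(b, c, d, e) \<in> set_pmf quad" for b c d e
    using that by (auto simp: set_quad Quads_def)
  \<comment> \<open>The exchange of \<open>c\<close> and \<open>d\<close> makes
    \<open>(b, d)\<close> and \<open>b - d\<close> as popular as \<open>(b, c)\<close> and
    \<open>b - c\<close>. The other two symmetries reverse the differences and swap the two
    pairs.\<close>
  have \<sigma>1: "ent quad (\<lambda>s. F ((\<lambda>(b, c, d, e). (b, d, c, e)) s)) = ent quad F" for F :: "_ \<Rightarrow> 'f"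
    by (rule quad_sym) (auto simp: Quads_def)
  have \<sigma>2: "ent quad (\<lambda>s. F ((\<lambda>(b, c, d, e). (c, b, e, d)) s)) = ent quad F" for F :: "_ \<Rightarrow> 'f"
    by (rule quad_sym) (auto simp: Quads_def)
  have \<sigma>3: "ent quad (\<lambda>s. F ((\<lambda>(b, c, d, e). (d, e, b, c)) s)) = ent quad F" for F :: "_ \<Rightarrow> 'f"
    by (rule quad_sym) (auto simp: Quads_def)
  have qc: "ent quad (\<lambda>(b, c, d, e). c) = q1" using \<sigma>2[of "\<lambda>(b, c, d, e). b"] by (simp add: q1_def case_prod_unfold)
  have qd: "ent quad (\<lambda>(b, c, d, e). d) = q1" using \<sigma>3[of "\<lambda>(b, c, d, e). b"] by (simp add: q1_def case_prod_unfold)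
  have qe: "ent quad (\<lambda>(b, c, d, e). e) = q1" using \<sigma>3[of "\<lambda>(b, c, d, e). c"] qc by (simp add: case_prod_unfold)
  have qbd: "ent quad (\<lambda>(b, c, d, e). (b, d)) = q2" using \<sigma>1[of ?bc] by (simp add: q2_def case_prod_unfold)
  have qce: "ent quad (\<lambda>(b, c, d, e). (c, e)) = q2" using \<sigma>2[of "\<lambda>(b, c, d, e). (b, d)"] qbd by (simp add: case_prod_unfold)
  have qxd: "ent quad (\<lambda>(b, c, d, e). b - d) = qx" using \<sigma>1[of "\<lambda>(b, c, d, e). b - c"] by (simp add: qx_def case_prod_unfold)
  have q1L: "q1 \<le> L" unfolding q1_def by (rule ent_A[OF bnd_quad]) (auto dest!: qs)
  have q3b: "q3 \<le> 2 * q2 - qx"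
  proof -
    have "q3 + qx \<le> q2 + ent quad (\<lambda>(b, c, d, e). (d, e))" unfolding q3_def qx_def q2_def
      by (rule ent_submod[OF fq]) (auto simp: det_def dest!: qs)
    moreover have "ent quad (\<lambda>(b, c, d, e). (d, e)) = q2" using \<sigma>3[of ?bc] by (simp add: q2_def case_prod_unfold)
    ultimately show ?thesis by argo
  qed
  have energy: "3 * L - \<kappa> \<le> q3" unfolding q3_def by (rule quad_energy)
  have p\<pi>: "ent \<pi> (\<lambda>s. s) = q2" "ent \<pi> fst = q1" "ent \<pi> snd = q1"
    using qc by (simp_all add: \<pi>_def ent_map q2_def q1_def case_prod_unfold)
  obtain \<rho> where r: "rs_for \<pi> \<rho>" using rs_law[OF \<pi>A] by blast
  have \<rho>: "bnd 6 \<rho>"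
    "\<And>a b x. (a, b, x) \<in> set_pmf \<rho> \<Longrightarrow> a \<in> A \<and> b \<in> A \<and> a + b - x \<in> sumset A"
    "map_pmf (\<lambda>(a, b, x). x) \<rho> = map_pmf (\<lambda>(b, c). b - c) \<pi>"
    "ent \<rho> (\<lambda>(a, b, x). b) = ent \<pi> fst"
    "3 * L + 6 * ent \<pi> (\<lambda>s. s) - 2 * (L + ent \<pi> fst + ent \<pi> snd) - 3 * err + 3 * ent \<pi> fst - 3 * \<kappa> \<le> 3 * ent \<rho> (\<lambda>s. s)"
    using r[unfolded rs_for_def] by simp_all
  define rho where "rho = ent \<rho> (\<lambda>s. s)"
  have RS: "3 * L + 6 * q2 - 2 * (L + q1 + q1) - 3 * err + 3 * q1 - 3 * \<kappa> \<le> 3 * rho"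
    using \<rho>(5) unfolding p\<pi> rho_def .

  text \<open>The base law: a representation \<open>x = b - c = d - e\<close> attached to the law of the pairs of sums.\<close>
  have eqR: "map_pmf (\<lambda>(a, v, x). x) \<rho> = map_pmf (\<lambda>(b, c, d, e). b - c) quad"
    unfolding \<rho>(3) \<pi>_def by (simp add: map_pmf_comp case_prod_unfold)
  note gR = eqR bnd_fin[OF \<rho>(1)] fq
  define R where "R = glue \<rho> (\<lambda>(a, v, x). x) quad (\<lambda>(b, c, d, e). b - c)"
  have bR: "bnd 10 R" using bnd_glue[OF eqR \<rho>(1) bnd_quad] by (simp add: R_def)
  have bR64: "bnd 64 R" by (rule bnd_mono[OF bR]) simp
  note fR = bnd_fin[OF bR]
  have sR: "a \<in> A \<and> v \<in> A \<and> b \<in> A \<and> c \<in> A \<and> d \<in> A \<and> e \<in> A \<and> a + v - b + c \<in> sumset A \<and> x = b - c \<and> e = d - b + c"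
    if "((a, v, x), (b, c, d, e)) \<in> set_pmf R" for a v x b c d e
  proof -
    have "(a, v, x) \<in> set_pmf \<rho>" "(b, c, d, e) \<in> set_pmf quad" "x = b - c"
      using that unfolding R_def set_glue[OF gR] by auto
    then show ?thesis using \<rho>(2)[of a v x] qs[of b c d e] by (auto simp: algebra_simps)
  qed
  have fR1: "map_pmf fst R = \<rho>" unfolding R_def by (rule fst_glue[OF gR])
  have fR2: "map_pmf snd R = quad" unfolding R_def by (rule snd_glue[OF gR])
  have R\<rho>: "ent R (\<lambda>s. F (fst s)) = ent \<rho> F" for F :: "_ \<Rightarrow> 'f"
    using ent_map[of fst R F] unfolding fR1 by simp
  have Rq: "ent R (\<lambda>s. F (snd s)) = ent quad F" for F :: "_ \<Rightarrow> 'f"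
    using ent_map[of snd R F] unfolding fR2 by simp
  have Rid: "ent R (\<lambda>s. s) = rho + q3 - qx"
  proof -
    have "ent \<rho> (\<lambda>(a, v, x). x) = qx"
      using ent_map[of "\<lambda>(a, v, x). x" \<rho> "\<lambda>x. x"] ent_map[of "\<lambda>(b, c, d, e). b - c" quad "\<lambda>x. x"] eqR
      by (simp add: qx_def case_prod_unfold)
    then show ?thesis unfolding R_def ent_glue[OF gR] rho_def q3_def by simp
  qed
  have Rbc: "ent R (\<lambda>((a, v, x), (b, c, d, e)). (b, c)) = q2" and Rc: "ent R (\<lambda>((a, v, x), (b, c, d, e)). c) = q1"
    and Rd: "ent R (\<lambda>((a, v, x), (b, c, d, e)). d) = q1" and Re: "ent R (\<lambda>((a, v, x), (b, c, d, e)). e) = q1"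
    and Rce: "ent R (\<lambda>((a, v, x), (b, c, d, e)). (c, e)) = q2" and Rbd: "ent R (\<lambda>((a, v, x), (b, c, d, e)). (b, d)) = q2"
    and Rb: "ent R (\<lambda>((a, v, x), (b, c, d, e)). b) = q1" and Rx: "ent R (\<lambda>((a, v, x), (b, c, d, e)). b - c) = qx"
    and Rxd: "ent R (\<lambda>((a, v, x), (b, c, d, e)). b - d) = qx"
    using Rq[of ?bc] Rq[of "\<lambda>(b, c, d, e). c"] Rq[of "\<lambda>(b, c, d, e). d"] Rq[of "\<lambda>(b, c, d, e). e"]
      Rq[of "\<lambda>(b, c, d, e). (c, e)"] Rq[of "\<lambda>(b, c, d, e). (b, d)"] Rq[of "\<lambda>(b, c, d, e). b"]
      Rq[of "\<lambda>(b, c, d, e). b - c"] Rq[of "\<lambda>(b, c, d, e). b - d"] qc qd qe qce qbd qxd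
    by (simp_all add: q1_def q2_def qx_def case_prod_unfold)
  have Rv: "ent R (\<lambda>((a, v, x), (b, c, d, e)). v) = q1"
    using R\<rho>[of "\<lambda>(a, v, x). v"] \<rho>(4) p\<pi> by (simp add: case_prod_unfold)
  have Ravx: "ent R (\<lambda>((a, v, x), (b, c, d, e)). (a, v, x)) = rho"
    using R\<rho>[of "\<lambda>s. s"] by (simp add: rho_def case_prod_unfold)
  \<comment> \<open>The central variable is \<open>y = v - b + c\<close>: its translates
    \<open>y + a\<close>, \<open>y + b = v + c\<close> and \<open>y + d = v + e\<close> all lie in
    \<open>sumset A\<close>, which gives \<open>r10\<close>, \<open>r7\<close> and
    \<open>r7e\<close>. In the names below, \<open>a2\<close> is \<open>a\<close>, \<open>b2\<close>
    is \<open>v\<close> and \<open>u\<close> is \<open>v + c\<close>. The second c of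
    \<open>H_b2cc\<close> is \<open>e\<close>, whereas \<open>d\<close> appears as the e of
    \<open>H_ey\<close> and as the second b of \<open>H_bby\<close>; the later laws call it
    \<open>e\<close>.\<close>
  define H_y where "H_y = ent R (\<lambda>((a, v, x), (b, c, d, e)). v - b + c)"
  define H_by where "H_by = ent R (\<lambda>((a, v, x), (b, c, d, e)). (v - b + c, b))"
  define H_ey where "H_ey = ent R (\<lambda>((a, v, x), (b, c, d, e)). (v - b + c, d))"
  define H_a2y where "H_a2y = ent R (\<lambda>((a, v, x), (b, c, d, e)). (a, v - b + c))"
  define H_ba2y where "H_ba2y = ent R (\<lambda>((a, v, x), (b, c, d, e)). (b, a, v - b + c))"
  define H_b2bc where "H_b2bc = ent R (\<lambda>((a, v, x), (b, c, d, e)). (v, b, c))"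
  define H_F where "H_F = ent R (\<lambda>((a, v, x), (b, c, d, e)). (a, v, b, c))"
  define H_b2x where "H_b2x = ent R (\<lambda>((a, v, x), (b, c, d, e)). (v, x))"
  define H_R1 where "H_R1 = ent R (\<lambda>((a, v, x), (b, c, d, e)). (v, b, c, d))"
  define H_T where "H_T = ent R (\<lambda>((a, v, x), (b, c, d, e)). (v + c, v + e))"
  define H_b2cc where "H_b2cc = ent R (\<lambda>((a, v, x), (b, c, d, e)). (v, c, e))"
  define H_bby where "H_bby = ent R (\<lambda>((a, v, x), (b, c, d, e)). (v - b + c, b, d))"
  define H_b2c where "H_b2c = ent R (\<lambda>((a, v, x), (b, c, d, e)). (v, c))"
  define H_u where "H_u = ent R (\<lambda>((a, v, x), (b, c, d, e)). v + c)"
  note RH = H_y_def H_by_def H_ey_def H_a2y_def H_ba2y_def H_b2bc_def H_F_def H_b2x_def H_R1_def H_T_def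
    H_b2cc_def H_bby_def H_b2c_def H_u_def
  have r1: "H_ba2y + H_y \<le> H_by + H_a2y" unfolding RH
    by (rule ent_submod[OF fR]) (auto simp: det_def dest!: sR)
  have r2: "H_F + H_by \<le> H_b2bc + H_ba2y" unfolding RH
    by (rule ent_submod[OF fR]) (auto simp: det_def dest!: sR)
  have r3q: "H_b2bc + qx \<le> H_b2x + q2" unfolding RH Rx[symmetric] Rbc[symmetric]
    by (rule ent_submod[OF fR]) (auto simp: det_def dest!: sR)
  \<comment> \<open>Lower bounds arise by reading submodularity backwards: the entropy of all of
    \<open>R\<close> is known exactly from \<open>Rid\<close>, so a variable that completes a known
    one to the whole of \<open>R\<close> cannot be small. The same idea gives
    \<open>r4p\<close>.\<close>
  have r3p: "rho + q2 - qx \<le> H_F"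
  proof -
    have "ent R (\<lambda>s. s) + q2 \<le> H_F + ent R (\<lambda>s. snd s)" unfolding RH Rbc[symmetric]
      by (rule ent_submod[OF fR]) (auto simp: det_def dest!: sR)
    then show ?thesis using Rq[of "\<lambda>s. s"] Rid unfolding q3_def by simp
  qed
  \<comment> \<open>\<open>(v, c, e)\<close> and \<open>(y, b, d)\<close> produce the same pair of
    sums \<open>(v + c, v + e) = (y + b, y + d)\<close>. In \<open>P1\<close> that pair is in turn
    bounded below by \<open>prism\<close>.\<close>
  have r4: "H_R1 + H_T \<le> H_b2cc + H_bby" unfolding RH
    by (rule ent_submod[OF fR]) (auto simp: det_def dest!: sR)
  have r4p: "H_b2x + q3 - qx \<le> H_R1"
  proof -
    have "ent R (\<lambda>s. s) + H_b2x \<le> H_R1 + rho" unfolding RH Ravx[symmetric]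
      by (rule ent_submod[OF fR]) (auto simp: det_def dest!: sR)
    then show ?thesis using Rid by simp
  qed
  have r5: "H_b2cc + q1 \<le> H_b2c + q2" unfolding RH Rc[symmetric] Rce[symmetric]
    by (rule ent_submod[OF fR]) (auto simp: det_def dest!: sR)
  have r6: "H_u \<le> L + \<kappa>" unfolding RH
    by (rule ent_S[OF bR]) (auto simp: sumset_def dest!: sR)
  have r7: "3 * H_by \<le> L + 2 * H_u + 2 * H_y + err"
  proof -
    have "3 * H_by + ent R (\<lambda>_. ()) \<le> L + 2 * H_u + 2 * H_y + err" unfolding RH
      by (rule ent_control[OF bR64, where \<beta> = "\<lambda>((a, v, x), (b, c, d, e)). v + c" and \<gamma> = "\<lambda>((a, v, x), (b, c, d, e)). - (v - b + c)"])
        (auto simp: det_def dest!: sR)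
    then show ?thesis by simp
  qed
  have r7e: "3 * H_ey \<le> L + 2 * (L + \<kappa>) + 2 * H_y + err"
  proof -
    have "3 * H_ey + ent R (\<lambda>_. ()) \<le> L + 2 * ent R (\<lambda>((a, v, x), (b, c, d, e)). v + e) + 2 * H_y + err" unfolding RH
      by (rule ent_control[OF bR64, where \<beta> = "\<lambda>((a, v, x), (b, c, d, e)). v + e" and \<gamma> = "\<lambda>((a, v, x), (b, c, d, e)). - (v - b + c)"])
        (auto simp: det_def dest!: sR)
    moreover have "ent R (\<lambda>((a, v, x), (b, c, d, e)). v + e) \<le> L + \<kappa>"
      by (rule ent_S[OF bR]) (use sR in \<open>fastforce simp: sumset_def\<close>)
    ultimately show ?thesis by simp
  qed
  have r8: "H_b2bc + q1 \<le> H_b2c + q2" unfolding RH Rc[symmetric] Rbc[symmetric]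
    by (rule ent_submod[OF fR]) (auto simp: det_def dest!: sR)
  have r9: "3 * H_b2bc + q1 \<le> L + 2 * H_b2c + 2 * H_b2x + err" unfolding RH Rv[symmetric]
    by (rule ent_control[OF bR64, where \<beta> = "\<lambda>((a, v, x), (b, c, d, e)). c" and \<gamma> = "\<lambda>((a, v, x), (b, c, d, e)). x"])
      (auto simp: det_def dest!: sR)
  have r10: "3 * H_a2y \<le> L + 2 * (L + \<kappa>) + 2 * H_y + err"
  proof -
    have "3 * H_a2y + ent R (\<lambda>_. ()) \<le> L + 2 * ent R (\<lambda>((a, v, x), (b, c, d, e)). a + v - b + c) + 2 * H_y + err" unfolding RH
      by (rule ent_control[OF bR64, where \<beta> = "\<lambda>((a, v, x), (b, c, d, e)). a + v - b + c" and \<gamma> = "\<lambda>((a, v, x), (b, c, d, e)). - (v - b + c)"])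
        (auto simp: det_def dest!: sR)
    moreover have "ent R (\<lambda>((a, v, x), (b, c, d, e)). a + v - b + c) \<le> L + \<kappa>"
      by (rule ent_S[OF bR]) (auto dest!: sR)
    ultimately show ?thesis by simp
  qed
  have P1: "6 * H_b2cc \<le> 3 * H_T + 3 * L + 2 * (q1 + q1 + q1) + 3 * err"
  proof -
    have "set_pmf (map_pmf (\<lambda>((a, v, x), (b, c, d, e)). (v, c, e)) R) \<subseteq> A \<times> A \<times> A" by (auto dest!: sR)
    from prism[OF this] show ?thesis using Rv Rc Re by (simp add: ent_map RH case_prod_unfold)
  qed

  define p1 where "p1 = map_pmf (\<lambda>((a, v, x), (b, c, d, e)). (v, b, c)) R"
  define p2 where "p2 = map_pmf (\<lambda>((a, v, x), (b, c, d, e)). (v - b + c, b, d)) R"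
  have b12: "bnd 10 p1" "bnd 10 p2" unfolding p1_def p2_def by (rule bnd_map[OF bR])+
  have eq2: "map_pmf (\<lambda>(v, b, c). (v - b + c, b)) p1 = map_pmf (\<lambda>(y, b, e). (y, b)) p2"
    by (simp add: p1_def p2_def map_pmf_comp case_prod_unfold)
  note g2 = eq2 bnd_fin[OF b12(1)] bnd_fin[OF b12(2)]
  \<comment> \<open>Given \<open>(y, b)\<close>, the former \<open>d\<close> is drawn afresh as
    \<open>e\<close>, independently of \<open>(v, c)\<close>; the coordinate \<open>g\<close> merely
    repeats \<open>b\<close>. The relation that put \<open>e - b + c\<close> in \<open>A\<close> is
    given up, but the pair of sums \<open>(y + b, y + e)\<close> keeps its law, as \<open>VT\<close>
    exploits.\<close>
  define T where "T = glue p1 (\<lambda>(v, b, c). (v - b + c, b)) p2 (\<lambda>(y, b, e). (y, b))"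
  have bT: "bnd 20 T" using bnd_glue[OF eq2 b12] by (simp add: T_def)
  have bT64: "bnd 64 T" by (rule bnd_mono[OF bT]) simp
  note fT = bnd_fin[OF bT]
  have sT: "v \<in> A \<and> b \<in> A \<and> c \<in> A \<and> e \<in> A \<and> g = b \<and> y = v - b + c"
    if "((v, b, c), (y, g, e)) \<in> set_pmf T" for v b c y g e
    using that unfolding T_def set_glue[OF g2] by (auto simp: p1_def p2_def dest!: sR)
  have fT1: "map_pmf fst T = p1" unfolding T_def by (rule fst_glue[OF g2])
  have fT2: "map_pmf snd T = p2" unfolding T_def by (rule snd_glue[OF g2])
  have T1: "ent T (\<lambda>s. F (fst s)) = ent p1 F" for F :: "_ \<Rightarrow> 'f"
    using ent_map[of fst T F] unfolding fT1 by simp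
  have T2: "ent T (\<lambda>s. F (snd s)) = ent p2 F" for F :: "_ \<Rightarrow> 'f"
    using ent_map[of snd T F] unfolding fT2 by simp
  define R2 where "R2 = ent T (\<lambda>s. s)"
  define H_cd where "H_cd = ent T (\<lambda>((v, b, c), (y, g, e)). (c, e - b))"
  define H_b2cd where "H_b2cd = ent T (\<lambda>((v, b, c), (y, g, e)). (v, c, e - b))"
  define H_bce where "H_bce = ent T (\<lambda>((v, b, c), (y, g, e)). (b, c, e))"
  have R2CI: "R2 = H_b2bc + H_bby - H_by"
    unfolding R2_def T_def ent_glue[OF g2] by (simp add: p1_def p2_def ent_map RH case_prod_unfold)
  have Tc: "ent T (\<lambda>((v, b, c), (y, g, e)). c) = q1" and Tbc: "ent T (\<lambda>((v, b, c), (y, g, e)). (b, c)) = q2"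
    and Tvbc: "ent T (\<lambda>((v, b, c), (y, g, e)). (v, b, c)) = H_b2bc"
    using T1[of "\<lambda>(v, b, c). c"] T1[of "\<lambda>(v, b, c). (b, c)"] T1[of "\<lambda>(v, b, c). (v, b, c)"] Rc Rbc
    by (simp_all add: p1_def ent_map RH case_prod_unfold)
  have t1: "R2 + H_cd \<le> H_b2cd + H_bce" unfolding R2_def H_cd_def H_b2cd_def H_bce_def
    by (rule ent_submod[OF fT]) (auto simp: det_def dest!: sT)
  have t2: "3 * H_bce + q1 \<le> L + 2 * q2 + 2 * H_cd + err"
    unfolding H_bce_def H_cd_def Tc[symmetric] Tbc[symmetric]
    by (rule ent_control[OF bT64, where \<beta> = "\<lambda>((v, b, c), (y, g, e)). b" and \<gamma> = "\<lambda>((v, b, c), (y, g, e)). e - b"])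
      (auto simp: det_def dest!: sT)

  define p3 where "p3 = map_pmf (\<lambda>((v, b, c), (y, g, e)). (v, v + c, v - b + c + e)) T"
  have b3: "bnd 20 p3" unfolding p3_def by (rule bnd_map[OF bT])
  have eq3: "map_pmf (\<lambda>((v, b, c), (y, g, e)). (v + c, v - b + c + e)) T = map_pmf (\<lambda>(w, u, t). (u, t)) p3"
    by (simp add: p3_def map_pmf_comp case_prod_unfold)
  note g3 = eq3 fT bnd_fin[OF b3]
  \<comment> \<open>With both sums \<open>u = v + c\<close> and \<open>t = y + e\<close> held fixed,
    a second representation \<open>u = w + (u - w)\<close> is drawn. As \<open>u = y + b\<close>,
    the new difference \<open>z = b - (u - w)\<close> satisfies \<open>y + z = w\<close>, so control
    applies to \<open>y\<close> and \<open>z\<close>, and \<open>pair_cap\<close> to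
    \<open>(b, u - w)\<close>.\<close>
  define V where "V = glue T (\<lambda>((v, b, c), (y, g, e)). (v + c, v - b + c + e)) p3 (\<lambda>(w, u, t). (u, t))"
  have bV: "bnd 40 V" using bnd_glue[OF eq3 bT b3] by (simp add: V_def)
  have bV64: "bnd 64 V" by (rule bnd_mono[OF bV]) simp
  note fV = bnd_fin[OF bV]
  have sV: "v \<in> A \<and> b \<in> A \<and> c \<in> A \<and> e \<in> A \<and> w \<in> A \<and> u - w \<in> A \<and> g = b \<and> y = v - b + c \<and> u = v + c \<and> t = v - b + c + e"
    if "(((v, b, c), (y, g, e)), (w, u, t)) \<in> set_pmf V" for v b c y g e w u t
  proof -
    have h: "((v, b, c), (y, g, e)) \<in> set_pmf T" "(w, u, t) \<in> set_pmf p3" "v + c = u" "v - b + c + e = t"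
      using that unfolding V_def set_glue[OF g3] by auto
    have "w \<in> A \<and> u - w \<in> A" using h(2) by (auto simp: p3_def dest!: sT)
    then show ?thesis using sT[OF h(1)] h(3,4) by auto
  qed
  have fV1: "map_pmf fst V = T" unfolding V_def by (rule fst_glue[OF g3])
  have fV2: "map_pmf snd V = p3" unfolding V_def by (rule snd_glue[OF g3])
  have V1: "ent V (\<lambda>s. F (fst s)) = ent T F" for F :: "_ \<Rightarrow> 'f"
    using ent_map[of fst V F] unfolding fV1 by simp
  have V2: "ent V (\<lambda>s. F (snd s)) = ent p3 F" for F :: "_ \<Rightarrow> 'f"
    using ent_map[of snd V F] unfolding fV2 by simp
  have VT: "ent T (\<lambda>((v, b, c), (y, g, e)). (v + c, v - b + c + e)) = H_T"
  proof -
    have "ent T (\<lambda>((v, b, c), (y, g, e)). (v + c, v - b + c + e)) = ent T (\<lambda>s. (\<lambda>(y, b, e). (y + b, y + e)) (snd s))"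
      by (rule ent_cong[OF fT]) (auto simp: det_def dest!: sT)
    also have "\<dots> = ent R (\<lambda>((a, v, x), (b, c, d, e)). (v - b + c + b, v - b + c + d))"
      unfolding T2 by (simp add: p2_def ent_map case_prod_unfold)
    also have "\<dots> = H_T" unfolding H_T_def by (rule ent_cong[OF fR]) (auto simp: det_def dest!: sR)
    finally show ?thesis .
  qed
  have p3id: "ent p3 (\<lambda>s. s) = H_b2cd"
  proof -
    have "ent p3 (\<lambda>s. s) = ent T (\<lambda>((v, b, c), (y, g, e)). (v, v + c, v - b + c + e))"
      by (simp add: p3_def ent_map case_prod_unfold)
    also have "\<dots> = H_b2cd" unfolding H_b2cd_def by (rule ent_cong[OF fT]) (auto simp: det_def)
    finally show ?thesis .
  qed
  define VV where "VV = ent V (\<lambda>s. s)"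
  have VCI: "VV = R2 + H_b2cd - H_T"
    unfolding VV_def V_def ent_glue[OF g3] VT p3id R2_def ..
  let ?V = "\<lambda>f. ent V (\<lambda>(((v, b, c), (y, g, e)), (w, u, t)). f v b c y e w u)"
  have Vy: "?V (\<lambda>v b c y e w u. y) = H_y" and Vby: "?V (\<lambda>v b c y e w u. (y, b)) = H_by"
    and Vey: "?V (\<lambda>v b c y e w u. (y, e)) = H_ey" and Vbby: "?V (\<lambda>v b c y e w u. (y, b, e)) = H_bby"
    and Vb2bc: "?V (\<lambda>v b c y e w u. (v, b, c)) = H_b2bc" and Ve: "?V (\<lambda>v b c y e w u. e) = q1"
    and Vbe: "?V (\<lambda>v b c y e w u. (b, e)) = q2" and Vd: "?V (\<lambda>v b c y e w u. b - e) = qx"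
  proof -
    have V12: "ent V (\<lambda>s. F (snd (fst s))) = ent p2 F" for F :: "_ \<Rightarrow> 'f"
      using V1[of "\<lambda>s. F (snd s)"] T2[of F] by simp
    have p2: "ent p2 F = ent R (\<lambda>s. F ((\<lambda>((a, v, x), (b, c, d, e)). (v - b + c, b, d)) s))" for F :: "_ \<Rightarrow> 'f"
      by (simp add: p2_def ent_map)
    show "?V (\<lambda>v b c y e w u. y) = H_y" using V12[of "\<lambda>(y, b, e). y"] by (simp add: p2 RH case_prod_unfold)
    show "?V (\<lambda>v b c y e w u. (y, e)) = H_ey" using V12[of "\<lambda>(y, b, e). (y, e)"] by (simp add: p2 RH case_prod_unfold)
    show "?V (\<lambda>v b c y e w u. e) = q1" using V12[of "\<lambda>(y, b, e). e"] Rd by (simp add: p2 case_prod_unfold)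
    have "?V (\<lambda>v b c y e w u. (y, b)) = ent V (\<lambda>s. (\<lambda>(y, b, e). (y, b)) (snd (fst s)))"
      by (rule ent_cong[OF fV]) (auto simp: det_def dest!: sV)
    then show "?V (\<lambda>v b c y e w u. (y, b)) = H_by" using V12[of "\<lambda>(y, b, e). (y, b)"] by (simp add: p2 RH case_prod_unfold)
    have "?V (\<lambda>v b c y e w u. (y, b, e)) = ent V (\<lambda>s. (\<lambda>s. s) (snd (fst s)))"
      by (rule ent_cong[OF fV]) (auto simp: det_def dest!: sV)
    then show "?V (\<lambda>v b c y e w u. (y, b, e)) = H_bby" using V12[of "\<lambda>s. s"] by (simp add: p2 RH case_prod_unfold)
    have "?V (\<lambda>v b c y e w u. (b, e)) = ent V (\<lambda>s. (\<lambda>(y, b, e). (b, e)) (snd (fst s)))"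
      by (rule ent_cong[OF fV]) (auto simp: det_def dest!: sV)
    then show "?V (\<lambda>v b c y e w u. (b, e)) = q2" using V12[of "\<lambda>(y, b, e). (b, e)"] Rbd by (simp add: p2 case_prod_unfold)
    have "?V (\<lambda>v b c y e w u. b - e) = ent V (\<lambda>s. (\<lambda>(y, b, e). b - e) (snd (fst s)))"
      by (rule ent_cong[OF fV]) (auto simp: det_def dest!: sV)
    then show "?V (\<lambda>v b c y e w u. b - e) = qx" using V12[of "\<lambda>(y, b, e). b - e"] Rxd by (simp add: p2 case_prod_unfold)
    show "?V (\<lambda>v b c y e w u. (v, b, c)) = H_b2bc"
      using V1[of "\<lambda>((v, b, c), (y, g, e)). (v, b, c)"] Tvbc by (simp add: case_prod_unfold)
  qed
  have Vcs: "?V (\<lambda>v b c y e w u. u - w) = q1"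
  proof -
    have "?V (\<lambda>v b c y e w u. u - w) = ent T (\<lambda>((v, b, c), (y, g, e)). (v + c) - v)"
      using V2[of "\<lambda>(w, u, t). u - w"] by (simp add: p3_def ent_map case_prod_unfold)
    then show ?thesis using Tc by (simp add: case_prod_unfold)
  qed
  \<comment> \<open>\<open>e - b\<close> is also \<open>t - u\<close>, a function of the glued sums;
    hence \<open>(u - w, e - b)\<close> has the law of \<open>(c, e - b)\<close> under
    \<open>T\<close>.\<close>
  have Vcd: "?V (\<lambda>v b c y e w u. (u - w, e - b)) = H_cd"
  proof -
    have "?V (\<lambda>v b c y e w u. (u - w, e - b)) = ent V (\<lambda>s. (\<lambda>(w, u, t). (u - w, t - u)) (snd s))"
      by (rule ent_cong[OF fV]) (auto simp: det_def dest!: sV)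
    also have "\<dots> = ent T (\<lambda>((v, b, c), (y, g, e)). ((v + c) - v, (v - b + c + e) - (v + c)))"
      unfolding V2 by (simp add: p3_def ent_map case_prod_unfold)
    also have "\<dots> = H_cd" unfolding H_cd_def by (rule ent_cong[OF fT]) (auto simp: det_def)
    finally show ?thesis .
  qed
  define H_byv where "H_byv = ?V (\<lambda>v b c y e w u. (b, y, w))"
  define H_z where "H_z = ?V (\<lambda>v b c y e w u. b - (u - w))"
  define H_bz where "H_bz = ?V (\<lambda>v b c y e w u. (b, u - w))"
  define H_yv where "H_yv = ?V (\<lambda>v b c y e w u. (y, w))"
  define H_b2bcv where "H_b2bcv = ?V (\<lambda>v b c y e w u. (v, b, c, w))"
  define H_beyv where "H_beyv = ?V (\<lambda>v b c y e w u. (b, e, y, w))"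
  define H_ez where "H_ez = ?V (\<lambda>v b c y e w u. (e, b - (u - w)))"
  define H_bez where "H_bez = ?V (\<lambda>v b c y e w u. (b, e, u - w))"
  define H_eyv where "H_eyv = ?V (\<lambda>v b c y e w u. (e, y, w))"
  note VH = H_byv_def H_z_def H_bz_def H_yv_def H_b2bcv_def H_beyv_def H_ez_def H_bez_def H_eyv_def VV_def
  have v1: "H_byv + H_z \<le> H_bz + H_yv" unfolding VH
    by (rule ent_submod[OF fV]) (auto simp: det_def dest!: sV)
  have v2: "H_b2bcv + H_by \<le> H_b2bc + H_byv" unfolding VH Vby[symmetric] Vb2bc[symmetric]
    by (rule ent_submod[OF fV]) (auto simp: det_def dest!: sV)
  have v34: "VV + H_by \<le> H_b2bc + H_beyv" unfolding VH Vby[symmetric] Vb2bc[symmetric]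
    by (rule ent_submod[OF fV]) (auto simp: det_def dest!: sV)
  have v5: "H_beyv + H_ez \<le> H_bez + H_eyv" unfolding VH
    by (rule ent_submod[OF fV]) (auto simp: det_def dest!: sV)
  have v67: "VV + H_by \<le> H_b2bcv + H_bby" unfolding VH Vby[symmetric] Vbby[symmetric]
    by (rule ent_submod[OF fV]) (auto simp: det_def dest!: sV)
  have v8: "VV + H_yv \<le> H_b2bcv + H_eyv" unfolding VH
    by (rule ent_submod[OF fV]) (auto simp: det_def dest!: sV)
  have v9: "3 * H_eyv + q1 \<le> L + 2 * H_ey + 2 * H_ez + err" unfolding VH Ve[symmetric] Vey[symmetric]
    by (rule ent_control[OF bV64, where \<beta> = "\<lambda>(((v, b, c), (y, g, e)), (w, u, t)). y" and \<gamma> = "\<lambda>(((v, b, c), (y, g, e)), (w, u, t)). b - (u - w)"])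
      (auto simp: det_def dest!: sV)
  have v10: "3 * H_bez + q1 \<le> L + 2 * H_bz + 2 * H_cd + err" unfolding VH Vcs[symmetric] Vcd[symmetric]
    by (rule ent_control[OF bV64, where \<beta> = "\<lambda>(((v, b, c), (y, g, e)), (w, u, t)). b" and \<gamma> = "\<lambda>(((v, b, c), (y, g, e)), (w, u, t)). e - b"])
      (auto simp: det_def dest!: sV)
  have v11: "3 * H_yv \<le> L + 2 * H_y + 2 * H_z + err"
  proof -
    have "3 * H_yv + ent V (\<lambda>_. ()) \<le> L + 2 * H_y + 2 * H_z + err" unfolding VH Vy[symmetric]
      by (rule ent_control[OF bV64, where \<beta> = "\<lambda>(((v, b, c), (y, g, e)), (w, u, t)). y" and \<gamma> = "\<lambda>(((v, b, c), (y, g, e)), (w, u, t)). b - (u - w)"])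
        (auto simp: det_def dest!: sV)
    then show ?thesis by simp
  qed
  have v12: "H_bez + qx \<le> q2 + H_cd" unfolding VH Vd[symmetric] Vbe[symmetric] Vcd[symmetric]
    by (rule ent_submod[OF fV]) (auto simp: det_def dest!: sV)
  have v13: "12 * H_bz - 5 * H_z \<le> 10 * L + 10 * \<kappa> + 12 * err"
  proof -
    have "set_pmf (map_pmf (\<lambda>(((v, b, c), (y, g, e)), (w, u, t)). (b, u - w)) V) \<subseteq> A \<times> A" by (auto dest!: sV)
    from pair_cap[OF this] show ?thesis by (simp add: ent_map VH case_prod_unfold)
  qed

  define p4 where "p4 = map_pmf (\<lambda>((a, v, x), (b, c, d, e)). (v, c)) R"
  have b4: "bnd 10 p4" unfolding p4_def by (rule bnd_map[OF bR])
  have eq4: "map_pmf (\<lambda>(y, b, e). y + b) p2 = map_pmf (\<lambda>(v, c). v + c) p4"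
    by (simp add: p2_def p4_def map_pmf_comp case_prod_unfold)
  note g4 = eq4 bnd_fin[OF b12(2)] bnd_fin[OF b4]
  \<comment> \<open>Unlike in \<open>V\<close>, only the single sum \<open>y + b\<close> is held
    fixed, and \<open>w\<close>, \<open>t\<close> are fresh summands of it. Then
    \<open>(b - w) + y = t\<close> lies in \<open>A\<close>, with \<open>b - w\<close> itself a
    difference of elements of \<open>A\<close>.\<close>
  define Y where "Y = glue p2 (\<lambda>(y, b, e). y + b) p4 (\<lambda>(v, c). v + c)"
  have bY: "bnd 20 Y" using bnd_glue[OF eq4 b12(2) b4] by (simp add: Y_def)
  have bY64: "bnd 64 Y" by (rule bnd_mono[OF bY]) simp
  note fY = bnd_fin[OF bY]
  have sY: "b \<in> A \<and> e \<in> A \<and> w \<in> A \<and> t \<in> A \<and> y = w + t - b" if "((y, b, e), (w, t)) \<in> set_pmf Y" for y b e w t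
    using that unfolding Y_def set_glue[OF g4] by (auto simp: p2_def p4_def dest!: sR)
  have fY1: "map_pmf fst Y = p2" unfolding Y_def by (rule fst_glue[OF g4])
  have fY2: "map_pmf snd Y = p4" unfolding Y_def by (rule snd_glue[OF g4])
  have Y1: "ent Y (\<lambda>s. F (fst s)) = ent p2 F" for F :: "_ \<Rightarrow> 'f"
    using ent_map[of fst Y F] unfolding fY1 by simp
  have Y2: "ent Y (\<lambda>s. F (snd s)) = ent p4 F" for F :: "_ \<Rightarrow> 'f"
    using ent_map[of snd Y F] unfolding fY2 by simp
  define YY where "YY = ent Y (\<lambda>s. s)"
  have YCI: "YY = H_bby + H_b2c - H_u"
    unfolding YY_def Y_def ent_glue[OF g4] by (simp add: p2_def p4_def ent_map RH case_prod_unfold)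
  have Yy: "ent Y (\<lambda>((y, b, e), (w, t)). y) = H_y" and Yby: "ent Y (\<lambda>((y, b, e), (w, t)). (y, b)) = H_by"
    and Ybby: "ent Y (\<lambda>((y, b, e), (w, t)). (y, b, e)) = H_bby" and Yb: "ent Y (\<lambda>((y, b, e), (w, t)). b) = q1"
    and Yw: "ent Y (\<lambda>((y, b, e), (w, t)). w) = q1"
    using Y1[of "\<lambda>(y, b, e). y"] Y1[of "\<lambda>(y, b, e). (y, b)"] Y1[of "\<lambda>(y, b, e). (y, b, e)"] Y1[of "\<lambda>(y, b, e). b"]
      Y2[of "\<lambda>(w, t). w"] Rb Rv
    by (simp_all add: p2_def p4_def ent_map RH case_prod_unfold)
  define H_bvw where "H_bvw = ent Y (\<lambda>((y, b, e), (w, t)). (b, w, t))"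
  define H_vb where "H_vb = ent Y (\<lambda>((y, b, e), (w, t)). b - w)"
  define H_bv where "H_bv = ent Y (\<lambda>((y, b, e), (w, t)). (b, w))"
  define H_wvb where "H_wvb = ent Y (\<lambda>((y, b, e), (w, t)). (t, b - w))"
  note YH = H_bvw_def H_vb_def H_bv_def H_wvb_def YY_def
  have y1: "YY + H_by \<le> H_bby + H_bvw" unfolding YH Yby[symmetric] Ybby[symmetric]
    by (rule ent_submod[OF fY]) (auto simp: det_def dest!: sY)
  have y2: "H_bvw + H_vb \<le> H_bv + H_wvb" unfolding YH
    by (rule ent_submod[OF fY]) (auto simp: det_def dest!: sY)
  have y3: "3 * H_wvb \<le> L + 2 * H_vb + 2 * H_y + err"
  proof -
    have "3 * H_wvb + ent Y (\<lambda>_. ()) \<le> L + 2 * H_vb + 2 * H_y + err" unfolding YH Yy[symmetric]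
      by (rule ent_control[OF bY64, where \<beta> = "\<lambda>((y, b, e), (w, t)). b - w" and \<gamma> = "\<lambda>((y, b, e), (w, t)). y"])
        (auto simp: det_def dest!: sY)
    then show ?thesis by simp
  qed
  have y4: "H_bv \<le> q1 + q1"
  proof -
    have "H_bv + ent Y (\<lambda>_. ()) \<le> q1 + q1" unfolding YH
      by (subst Yb[symmetric], subst Yw[symmetric], rule ent_submod[OF fY]) (auto simp: det_def dest!: sY)
    then show ?thesis by simp
  qed
  have y5: "12 * H_bv - 5 * H_vb \<le> 10 * L + 10 * \<kappa> + 12 * err"
  proof -
    have "set_pmf (map_pmf (\<lambda>((y, b, e), (w, t)). (b, w)) Y) \<subseteq> A \<times> A" by (auto dest!: sY)
    from pair_cap[OF this] show ?thesis by (simp add: ent_map YH case_prod_unfold)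
  qed
  show ?thesis
    by (rule entropy_certificate[OF energy q3b q1L RS r1 r2 r3q r3p r4 r4p r5 r6 r7 r7e r8 r9 r10 P1 R2CI t1 t2 VCI
      v1 v2 v34 v5 v67 v8 v9 v10 v11 v12 v13 YCI y1 y2 y3 y4 y5 err_nonneg])
qed
end


section \<open>From entropies back to cardinalities\<close>

theorem theorem1p4:
  fixes \<epsilon> :: real
  assumes "\<epsilon> > 0"
  shows "\<exists>c > 0. \<forall>A :: real set. convex_set A \<longrightarrow>
           real (card (sumset A)) \<ge> c * real (card A) powr (46/29 - \<epsilon>)"
proof -
  \<comment> \<open>The error \<open>12 * err\<close> contains \<open>72 * ln (L + 1)\<close>.
    Applying \<open>ln t \<le> t - 1\<close> to \<open>t = \<delta> * (L + 1)\<close> turns this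
    into at most \<open>\<epsilon> * L\<close> plus a constant, which \<open>C\<close> collects;
    2720000 is 17 times the square of 400.\<close>
  define \<delta> where "\<delta> = \<epsilon> / 72"
  define C where "C = 36 * ln 2720000 + \<epsilon> - 72 * ln \<delta>"
  have \<delta>: "\<delta> > 0" using assms by (simp add: \<delta>_def)
  show ?thesis
  proof (intro exI[of _ "exp (- C)"] conjI allI impI)
    fix A :: "real set" assume A: "convex_set A"
    show "exp (- C) * real (card A) powr (46/29 - \<epsilon>) \<le> real (card (sumset A))"
    proof (cases "A = {}")
      case False
      then interpret convex_law A using A by unfold_locales
      have N: "real (card A) \<ge> 1" using N1 by simp
      have L0: "0 \<le> L" using N by (simp add: L_def)
      have ln2: "1/2 \<le> ln (2::real)" using ln_2_less_1 ln2_ge_two_thirds by linarith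
      have "log 2 (real (card A)) \<le> 2 * L"
      proof -
        have "log 2 (real (card A)) = L / ln 2" by (simp add: log_def L_def)
        also have "\<dots> \<le> L / (1/2)" using ln2 L0 by (intro divide_left_mono) auto
        finally show ?thesis by simp
      qed
      moreover have "real m \<le> 192 * log 2 (real (card A)) + 1"
        unfolding m_def using N by (simp add: of_nat_nat)
      ultimately have m1: "real m + 1 \<le> 400 * (L + 1)" using L0 by argo
      have "17 * (real m + 1)^2 \<le> 17 * (400 * (L + 1))^2" using m1 by (intro mult_left_mono power_mono) auto
      also have "\<dots> = 2720000 * (L + 1)^2" by (simp add: power2_eq_square algebra_simps)
      finally have le: "17 * (real m + 1)^2 \<le> 2720000 * (L + 1)^2" .
      have p1: "0 < 17 * (real m + 1)^2" by (intro mult_pos_pos zero_less_power) auto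
      have p2: "0 < 2720000 * (L + 1)^2" using p1 le by (rule less_le_trans)
      have L1: "0 < L + 1" using L0 by simp
      have "ln (17 * (real m + 1)^2) \<le> ln (2720000 * (L + 1)^2)"
        using le by (subst ln_le_cancel_iff[OF p1 p2])
      also have "\<dots> = ln 2720000 + 2 * ln (L + 1)"
        using L1 by (subst ln_mult) (simp_all add: ln_realpow)
      finally have e: "12 * err \<le> 36 * ln 2720000 + 72 * ln (L + 1)" unfolding err_def by argo
      define t where "t = \<delta> * (L + 1)"
      have tL: "72 * t = \<epsilon> * L + \<epsilon>" by (simp add: t_def \<delta>_def algebra_simps)
      have tp: "0 < t" unfolding t_def using \<delta> L1 by (rule mult_pos_pos)
      have "ln t \<le> t - 1" using tp by (rule ln_le_minus_one)
      moreover have "ln t = ln \<delta> + ln (L + 1)" unfolding t_def using \<delta> L1 by (simp add: ln_mult)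
      moreover define T where "T = \<epsilon> * L"
      ultimately have e2: "12 * err \<le> T + C" using e tL unfolding C_def by argo
      define S where "S = ln (real (card (sumset A)))"
      \<comment> \<open>17/29 is just below 3096/5280, and 348 = 29 * 12 exceeds 29 * 60000 / 5280,
        so dividing by 29 leaves exactly the \<open>12 * err\<close> estimated above.\<close>
      have "17 * L \<le> 29 * \<kappa> + 348 * err" using entropy_bound L0 err_nonneg by argo
      then have h: "46 * L / 29 - T - C \<le> S" using e2 unfolding \<kappa>_def S_def by argo
      have x: "(46/29 - \<epsilon>) * L = 46 * L / 29 - T" by (simp add: T_def algebra_simps)
      have pos: "0 < real (card (sumset A))"
      proof -
        obtain a where "a \<in> A" using False by blast
        then have "a + a \<in> sumset A" unfolding sumset_def by blast
        then show ?thesis using finS by (auto simp: card_gt_0_iff)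
      qed
      have "exp ((46/29 - \<epsilon>) * L - C) \<le> real (card (sumset A))"
        using h pos unfolding x S_def by (simp add: ln_ge_iff)
      moreover have "exp ((46/29 - \<epsilon>) * L - C) = exp (- C) * exp ((46/29 - \<epsilon>) * L)"
        using exp_add[of "- C" "(46/29 - \<epsilon>) * L"] by simp
      moreover have "real (card A) powr (46/29 - \<epsilon>) = exp ((46/29 - \<epsilon>) * L)"
      proof -
        have "real (card A) \<noteq> 0" using N by linarith
        then show ?thesis unfolding powr_def L_def by simp
      qed
      ultimately show ?thesis by simp
    \<comment> \<open>For empty \<open>A\<close> the left side vanishes because
      \<open>0 powr x = 0\<close> for every \<open>x\<close>, including exponents that are not
      positive.\<close>
    qed simp
  qed simp
qed

end
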